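(* Let $\mathcal D_n=(\phi_\omega^n:\omega\in\Omega_n)$ be frames of $\mathbb R^{I_n}$ having normalized frame elements and analysis operators $\boldsymbol\Phi_n$, and let $(\epsilon_n)_{n\in\mathbb N}$ be a sequence of noise vectors in $\mathbb R^{I_n}$ with independent $N(0,\sigma^2)$-distributed entries. Consider, for a sequence of thresholds $(T_n)_{n\in\mathbb N}$, the denoising property $$\lim_{n\to\infty}\mathbf P\{\|\boldsymbol\Phi_n\epsilon_n\|_\infty\le T_n\}=1\tag{1}$$ and the representation $$T_n=\sigma\sqrt{2\log|\Omega_n|}+\sigma\,\frac{2z_n-\log\log|\Omega_n|-\log\pi}{2\sqrt{2\log|\Omega_n|}}\quad\text{with}\quad\lim_{n\to\infty}z_n=\infty.\tag{2}$$ (a) If $(\mathcal D_n)_{n\in\mathbb N}$ is asymptotically stable, then a sequence $(T_n)_{n\in\mathbb N}$ of thresholds satisfies (1) if and only if it has the form (2). (b) If $(\mathcal D_n)_{n\in\mathbb N}$ is not necessarily asymptotically stable, then still any sequence $(T_n)_{n\in\mathbb N}\subset(0,\infty)$ of the form (2) satisfies (1).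
   Context: Fix $d\in\mathbb N$ and $\sigma>0$; $I_n=\{0,\dots,n-1\}^d$, and $\mathbb R^{I_n}$ carries the Euclidean inner product $\langle\cdot,\cdot\rangle$ and norm $\|\cdot\|$. $\mathcal D_n=(\phi_\omega^n:\omega\in\Omega_n)$, with $\Omega_n$ finite, is a frame of $\mathbb R^{I_n}$ if there are $0<a_n\le b_n<\infty$ with $a_n\|u\|^2\le\sum_{\omega}|\langle\phi_\omega^n,u\rangle|^2\le b_n\|u\|^2$ for all $u$; the frame bounds $a_n,b_n$ are the largest, respectively smallest, such constants. Normalized means $\|\phi_\omega^n\|=1$ for all $\omega$. The analysis operator $\boldsymbol\Phi_n:\mathbb R^{I_n}\to\mathbb R^{\Omega_n}$ is $(\boldsymbol\Phi_nu)(\omega)=\langle\phi_\omega^n,u\rangle$, and $\|x\|_\infty=\max_\omega|x(\omega)|$. A family of frames with normalized elements is asymptotically stable if (i) for some $\rho\in(0,1)$, $|\{(\omega,\omega')\in\Omega_n^2:\omega\ne\omega',\ |\langle\phi_\omega^n,\phi_{\omega'}^n\rangle|\ge\rho\}|=o\big(|\Omega_n|/\sqrt{\log|\Omega_n|}\big)$ as $n\to\infty$; and (ii) $\sup_n b_n<\infty$. *)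

theory Defs
  imports "HOL-Probability.Probability" "HOL-Library.Landau_Symbols"
begin

text \<open>
  The Euclidean space over a finite index set \<open>I\<close> is represented by all real functions on the
  ambient type of \<open>I\<close>; every notion below only looks at their values on \<open>I\<close>.  Its norm is
  \<^const>\<open>L2_set\<close>.  The index sets \<open>\<Omega> n\<close> live in one common type, which is no restriction since
  they are finite.
\<close>

definition grid :: "nat \<Rightarrow> nat \<Rightarrow> (nat \<Rightarrow> nat) set" where
  "grid d n = {..<d} \<rightarrow>\<^sub>E {..<n}"

definition inner_on :: "'i set \<Rightarrow> ('i \<Rightarrow> real) \<Rightarrow> ('i \<Rightarrow> real) \<Rightarrow> real" where
  "inner_on I u v = (\<Sum>k\<in>I. u k * v k)"

definition is_frame :: "'i set \<Rightarrow> 'w set \<Rightarrow> ('w \<Rightarrow> 'i \<Rightarrow> real) \<Rightarrow> bool" where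
  "is_frame I \<Omega> \<phi> \<longleftrightarrow> finite \<Omega> \<and>
     (\<exists>a b. 0 < a \<and> a \<le> b \<and>
        (\<forall>u. a * (L2_set u I)\<^sup>2 \<le> (\<Sum>\<omega>\<in>\<Omega>. \<bar>inner_on I (\<phi> \<omega>) u\<bar>\<^sup>2) \<and>
             (\<Sum>\<omega>\<in>\<Omega>. \<bar>inner_on I (\<phi> \<omega>) u\<bar>\<^sup>2) \<le> b * (L2_set u I)\<^sup>2))"

text \<open>
  The smallest admissible upper constant; for a frame over a nonempty \<open>I\<close> the infimum is attained.
\<close>

definition upper_frame_bound :: "'i set \<Rightarrow> 'w set \<Rightarrow> ('w \<Rightarrow> 'i \<Rightarrow> real) \<Rightarrow> real" where
  "upper_frame_bound I \<Omega> \<phi> =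
     Inf {b. \<forall>u. (\<Sum>\<omega>\<in>\<Omega>. \<bar>inner_on I (\<phi> \<omega>) u\<bar>\<^sup>2) \<le> b * (L2_set u I)\<^sup>2}"

definition normalized :: "'i set \<Rightarrow> 'w set \<Rightarrow> ('w \<Rightarrow> 'i \<Rightarrow> real) \<Rightarrow> bool" where
  "normalized I \<Omega> \<phi> \<longleftrightarrow> (\<forall>\<omega>\<in>\<Omega>. L2_set (\<phi> \<omega>) I = 1)"

definition analysis_op :: "'i set \<Rightarrow> ('w \<Rightarrow> 'i \<Rightarrow> real) \<Rightarrow> ('i \<Rightarrow> real) \<Rightarrow> 'w \<Rightarrow> real" where
  "analysis_op I \<phi> u \<omega> = inner_on I (\<phi> \<omega>) u"

definition max_norm :: "'w set \<Rightarrow> ('w \<Rightarrow> real) \<Rightarrow> real" where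
  "max_norm \<Omega> x = Max ((\<lambda>\<omega>. \<bar>x \<omega>\<bar>) ` \<Omega>)"

text \<open>Sequences are indexed by \<open>n \<ge> 1\<close>; the values at \<open>n = 0\<close> are irrelevant throughout.\<close>

definition asymptotically_stable ::
    "nat \<Rightarrow> (nat \<Rightarrow> 'w set) \<Rightarrow> (nat \<Rightarrow> 'w \<Rightarrow> (nat \<Rightarrow> nat) \<Rightarrow> real) \<Rightarrow> bool" where
  "asymptotically_stable d \<Omega> \<phi> \<longleftrightarrow>
     (\<exists>\<rho>. 0 < \<rho> \<and> \<rho> < 1 \<and>
        (\<lambda>n. real (card {(\<omega>, \<omega>') \<in> \<Omega> n \<times> \<Omega> n.
                 \<omega> \<noteq> \<omega>' \<and> \<bar>inner_on (grid d n) (\<phi> n \<omega>) (\<phi> n \<omega>')\<bar> \<ge> \<rho>}))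
          \<in> o(\<lambda>n. real (card (\<Omega> n)) / sqrt (ln (real (card (\<Omega> n)))))) \<and>
     bdd_above ((\<lambda>n. upper_frame_bound (grid d n) (\<Omega> n) (\<phi> n)) ` {1..})"

definition gaussian_noise ::
    "'a measure \<Rightarrow> nat \<Rightarrow> real \<Rightarrow> (nat \<Rightarrow> (nat \<Rightarrow> nat) \<Rightarrow> 'a \<Rightarrow> real) \<Rightarrow> bool" where
  "gaussian_noise M d \<sigma> \<epsilon> \<longleftrightarrow>
     (\<forall>n\<ge>1. prob_space.indep_vars M (\<lambda>_. borel) (\<epsilon> n) (grid d n) \<and>
            (\<forall>k\<in>grid d n. distributed M lborel (\<epsilon> n k) (normal_density 0 \<sigma>)))"

definition denoising_property ::
    "'a measure \<Rightarrow> nat \<Rightarrow> (nat \<Rightarrow> 'w set) \<Rightarrow> (nat \<Rightarrow> 'w \<Rightarrow> (nat \<Rightarrow> nat) \<Rightarrow> real) \<Rightarrow>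
     (nat \<Rightarrow> (nat \<Rightarrow> nat) \<Rightarrow> 'a \<Rightarrow> real) \<Rightarrow> (nat \<Rightarrow> real) \<Rightarrow> bool" where
  "denoising_property M d \<Omega> \<phi> \<epsilon> T \<longleftrightarrow>
     (\<lambda>n. measure M {x \<in> space M.
            max_norm (\<Omega> n) (analysis_op (grid d n) (\<phi> n) (\<lambda>k. \<epsilon> n k x)) \<le> T n})
       \<longlonglongrightarrow> 1"

text \<open>
  The formula is meaningless when \<open>card (\<Omega> n) = 1\<close> (then \<open>ln (ln 1)\<close> and a division by \<open>ln 1 = 0\<close>
  occur), so no condition is imposed there.  For frames in dimension \<open>d \<ge> 1\<close> this can only happen
  at \<open>n = 1\<close>, because a frame has at least \<open>n ^ d\<close> elements.
\<close>

definition threshold_form :: "real \<Rightarrow> (nat \<Rightarrow> 'w set) \<Rightarrow> (nat \<Rightarrow> real) \<Rightarrow> bool" where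
  "threshold_form \<sigma> \<Omega> T \<longleftrightarrow>
     (\<exists>z :: nat \<Rightarrow> real. filterlim z at_top sequentially \<and>
        (\<forall>n\<ge>1. card (\<Omega> n) \<ge> 2 \<longrightarrow>
           (let L = ln (real (card (\<Omega> n))) in
            T n = \<sigma> * sqrt (2 * L) + \<sigma> * ((2 * z n - ln L - ln pi) / (2 * sqrt (2 * L))))))"

end

theory Submission
  imports Defs "HOL-Real_Asymp.Real_Asymp"
begin

text \<open>
  Let \<open>N\<close> be the number of frame elements and let \<open>t\<close> be the threshold, divided by \<open>\<sigma>\<close>, for a fixed
  value \<open>z\<close>.  Then \<open>N * P(\<bar>Z\<bar> > t)\<close> for standard normal \<open>Z\<close> stays between two positive constants, and
  the upper one tends to 0 as \<open>z\<close> grows.  Hence the union bound shows that the form of the thresholds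
  is sufficient.

  For necessity it is enough that, for each fixed \<open>z\<close>, the probability of exceeding the threshold
  stays away from 0, and this follows from the second moment method.  The pair probabilities are
  split by the correlation \<open>r\<close>: pairs with \<open>\<bar>r\<bar> \<ge> \<rho>\<close> are few by stability; since the squared
  correlations of one element with all others sum to at most the frame bound, there are at most
  \<open>N * b * (ln N)\<^sup>2\<close> pairs with \<open>\<bar>r\<bar> \<ge> 1 / ln N\<close>, each contributing at most \<open>2 * P(\<bar>X \<plusminus> Y\<bar> > 2 * t)\<close>,
  which for \<open>\<bar>r\<bar> < \<rho>\<close> is of order \<open>N\<close> to a power below \<open>-1\<close>; for \<open>\<bar>r\<bar> < 1 / ln N\<close> the two
  coefficients are independent up to a constant factor.
\<close>

section \<open>Independence from characteristic functions\<close>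

lemma (in prob_space) expectation_indicator_comp:
  fixes X :: "'a \<Rightarrow> real"
  assumes [measurable]: "random_variable borel X" "A \<in> sets borel"
  shows "expectation (\<lambda>x. indicator A (X x)) = prob {x \<in> space M. X x \<in> A}"
proof -
  have "expectation (\<lambda>x. indicator A (X x) :: real) = expectation (indicator {x \<in> space M. X x \<in> A})"
    by (intro Bochner_Integration.integral_cong refl) (auto simp: indicator_def)
  then show ?thesis by simp
qed

text \<open>Tilting \<open>M\<close> by the density \<open>(2 + h) / (2 + E h)\<close> leaves the characteristic function of \<open>X\<close>
  unchanged, hence by Levy uniqueness its law.\<close>

lemma (in prob_space) expectation_indicator_factor:
  fixes X h :: "'a \<Rightarrow> real"
  assumes X [measurable]: "random_variable borel X" and h [measurable]: "random_variable borel h"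
    and bound: "\<And>x. \<bar>h x\<bar> \<le> 1"
    and char: "\<And>a. (CLINT x|M. iexp (a * X x) * complex_of_real (h x)) =
                 (CLINT x|M. iexp (a * X x)) * complex_of_real (expectation h)"
    and A [measurable]: "A \<in> sets borel"
  shows "expectation (\<lambda>x. indicator A (X x) * h x) = prob {x \<in> space M. X x \<in> A} * expectation h"
proof -
  have int_h: "integrable M h"
    by (rule integrable_const_bound[where B = 1]) (use bound in auto)
  have int_e: "complex_integrable M (\<lambda>x. iexp (a * X x))" for a
    by (rule integrable_const_bound[where B = 1]) auto
  have int_eh: "complex_integrable M (\<lambda>x. iexp (a * X x) * complex_of_real (h x))" for a
    by (rule integrable_const_bound[where B = 1]) (use bound in \<open>auto simp: norm_mult\<close>)
  have int_A: "integrable M (\<lambda>x. indicator A (X x) :: real)"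
    by (rule integrable_const_bound[where B = 1]) (auto simp: indicator_def)
  have int_Ah: "integrable M (\<lambda>x. indicator A (X x) * h x)"
    by (rule integrable_const_bound[where B = 1]) (use bound in \<open>auto simp: indicator_def\<close>)
  have "\<bar>expectation h\<bar> \<le> expectation (\<lambda>x. \<bar>h x\<bar>)" 
    by (rule integral_abs_bound)
  also have "\<dots> \<le> expectation (\<lambda>x. 1)"
    using int_h bound by (intro integral_mono) auto
  finally have Eh: "\<bar>expectation h\<bar> \<le> 1" by (simp add: prob_space)
  \<comment> \<open>The shift by 2 keeps \<open>2 + h\<close> and its mean \<open>m\<close>
    positive, since \<open>h\<close> and \<open>expectation h\<close> lie between -1 and 1.\<close>
  define m where "m = 2 + expectation h"
  have m: "m > 0" using Eh by (simp add: m_def)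
  define g where "g x = (2 + h x) / m" for x
  have g_nn: "g x \<ge> 0" for x
    using m bound[of x] by (auto simp: g_def abs_le_iff)
  have [measurable]: "g \<in> borel_measurable M" unfolding g_def by measurable
  have Eg: "expectation g = 1" and int_g: "integrable M g"
    using int_h m by (auto simp: g_def [abs_def] prob_space m_def)
  define N where "N = density M (\<lambda>x. ennreal (g x))"
  have [measurable_cong]: "sets N = sets M" by (simp add: N_def)
  have sp: "space N = space M" by (simp add: N_def)
  have "emeasure N (space N) = 1"
    using Eg int_g g_nn by (simp add: N_def emeasure_density nn_integral_eq_integral cong: nn_integral_cong)
  then interpret N: prob_space N by (rule prob_spaceI)
  have "char (distr N borel X) a = char (distr M borel X) a" for a
  proof -
    have "char (distr N borel X) a = (CLINT x|N. iexp (a * X x))"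
      by (simp add: char_def integral_distr)
    also have "\<dots> = (CLINT x|M. g x *\<^sub>R iexp (a * X x))"
      unfolding N_def using g_nn by (intro integral_density) auto
    also have "\<dots> = (CLINT x|M. (2 * iexp (a * X x) + iexp (a * X x) * complex_of_real (h x)) / complex_of_real m)"
      by (intro Bochner_Integration.integral_cong refl)
         (simp add: g_def scaleR_conv_of_real field_simps)
    also have "\<dots> = (2 * (CLINT x|M. iexp (a * X x)) + (CLINT x|M. iexp (a * X x)) * complex_of_real (expectation h)) / complex_of_real m"
      using int_e int_eh by (simp add: char del: of_real_mult)
    also have "\<dots> = (CLINT x|M. iexp (a * X x))"
    proof -
      have "complex_of_real m = 2 + complex_of_real (expectation h)" by (simp add: m_def)
      moreover have "complex_of_real m \<noteq> 0" using m by simp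
      ultimately show ?thesis by (simp add: field_simps)
    qed
    finally show ?thesis by (simp add: char_def integral_distr)
  qed
  then have "distr N borel X = distr M borel X"
    by (intro Levy_uniqueness real_distribution_distr N.real_distribution_distr) auto
  then have "measure (distr N borel X) A = measure (distr M borel X) A" by simp
  then have eq: "measure N {x \<in> space M. X x \<in> A} = prob {x \<in> space M. X x \<in> A}"
    by (simp add: measure_distr vimage_def Int_def conj_commute sp)
  have "measure N {x \<in> space M. X x \<in> A} = (LINT x|N. indicator A (X x))"
  proof -
    have "(LINT x|N. indicator A (X x)) = (LINT x|N. indicator {x \<in> space M. X x \<in> A} x :: real)"
      by (intro Bochner_Integration.integral_cong refl) (auto simp: indicator_def sp)
    then show ?thesis by (simp add: sp)
  qed
  also have "\<dots> = (LINT x|M. g x *\<^sub>R indicator A (X x))"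
    unfolding N_def using g_nn by (intro integral_density) auto
  also have "\<dots> = (LINT x|M. (2 * indicator A (X x) + indicator A (X x) * h x) / m)"
    by (intro Bochner_Integration.integral_cong refl) (simp add: g_def field_simps)
  also have "\<dots> = (2 * expectation (\<lambda>x. indicator A (X x)) + expectation (\<lambda>x. indicator A (X x) * h x)) / m"
    using int_A int_Ah by simp
  also have "expectation (\<lambda>x. indicator A (X x)) = prob {x \<in> space M. X x \<in> A}"
    by (rule expectation_indicator_comp) measurable
  finally show ?thesis using eq m by (simp add: m_def field_simps)
qed

text \<open>Kac's theorem; only the one-dimensional uniqueness theorem is available, so it is applied once in
  each variable.\<close>

lemma (in prob_space) prob_factor_of_char_factor:
  fixes X Y :: "'a \<Rightarrow> real"
  assumes X [measurable]: "random_variable borel X" and Y [measurable]: "random_variable borel Y"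
    and char: "\<And>a b. (CLINT x|M. iexp (a * X x + b * Y x)) =
                 (CLINT x|M. iexp (a * X x)) * (CLINT x|M. iexp (b * Y x))"
    and A [measurable]: "A \<in> sets borel" and B [measurable]: "B \<in> sets borel"
  shows "prob {x \<in> space M. X x \<in> A \<and> Y x \<in> B} =
           prob {x \<in> space M. X x \<in> A} * prob {x \<in> space M. Y x \<in> B}"
proof -
  have int: "complex_integrable M (\<lambda>x. iexp (a * X x + b * Y x))" for a b
    by (rule integrable_const_bound[where B = 1]) auto
  have intY: "complex_integrable M (\<lambda>x. iexp (b * Y x))" for b
    by (rule integrable_const_bound[where B = 1]) auto
  have int_cos: "integrable M (\<lambda>x. cos (b * Y x))" and int_sin: "integrable M (\<lambda>x. sin (b * Y x))" for b
    by (rule integrable_const_bound[where B = 1]; simp)+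
  have cos_eq: "complex_of_real (cos y) = (iexp y + iexp (- y)) / 2"
    and sin_eq: "complex_of_real (sin y) = (iexp y - iexp (- y)) / (2 * \<i>)" for y
    by (auto simp: cos_of_real[symmetric] sin_of_real[symmetric] cos_exp_eq sin_exp_eq)
  \<comment> \<open>The tilting lemma is applied with \<open>h\<close> the real and then the
    imaginary part of \<open>iexp (b * Y)\<close>. Both are combinations of characters at
    \<open>b\<close> and \<open>- b\<close>, so the factorisation of the joint characteristic
    function supplies its hypothesis.\<close>
  have Ecos: "expectation (\<lambda>x. indicator A (X x) * cos (b * Y x)) =
      prob {x \<in> space M. X x \<in> A} * expectation (\<lambda>x. cos (b * Y x))" for b
  proof (rule expectation_indicator_factor)
    fix a
    have "complex_of_real (expectation (\<lambda>x. cos (b * Y x))) =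
        (CLINT x|M. (iexp (b * Y x) + iexp (- b * Y x)) / 2)"
      by (subst integral_complex_of_real[symmetric]) (simp only: cos_eq mult_minus_left)
    also have "\<dots> = ((CLINT x|M. iexp (b * Y x)) + (CLINT x|M. iexp (- b * Y x))) / 2"
      using intY[of b] intY[of "- b"] by simp
    finally have 1: "complex_of_real (expectation (\<lambda>x. cos (b * Y x))) = \<dots>" .
    have "(CLINT x|M. iexp (a * X x) * complex_of_real (cos (b * Y x))) =
        (CLINT x|M. (iexp (a * X x + b * Y x) + iexp (a * X x + (- b) * Y x)) / 2)"
      by (intro Bochner_Integration.integral_cong refl)
         (simp add: cos_eq exp_add[symmetric] exp_diff algebra_simps field_simps exp_minus)
    also have "\<dots> = ((CLINT x|M. iexp (a * X x + b * Y x)) + (CLINT x|M. iexp (a * X x + (- b) * Y x))) / 2"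
      using int[of a b] int[of a "- b"] by simp
    also have "\<dots> = (CLINT x|M. iexp (a * X x)) * complex_of_real (expectation (\<lambda>x. cos (b * Y x)))"
      unfolding 1 char by (simp only: algebra_simps times_divide_eq_right)
    finally show "(CLINT x|M. iexp (a * X x) * complex_of_real (cos (b * Y x))) = \<dots>" .
  qed auto
  have Esin: "expectation (\<lambda>x. indicator A (X x) * sin (b * Y x)) =
      prob {x \<in> space M. X x \<in> A} * expectation (\<lambda>x. sin (b * Y x))" for b
  proof (rule expectation_indicator_factor)
    fix a
    have "complex_of_real (expectation (\<lambda>x. sin (b * Y x))) =
        (CLINT x|M. (iexp (b * Y x) - iexp (- b * Y x)) / (2 * \<i>))"
      by (subst integral_complex_of_real[symmetric]) (simp only: sin_eq mult_minus_left)
    also have "\<dots> = ((CLINT x|M. iexp (b * Y x)) - (CLINT x|M. iexp (- b * Y x))) / (2 * \<i>)"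
      using intY[of b] intY[of "- b"] by simp
    finally have 1: "complex_of_real (expectation (\<lambda>x. sin (b * Y x))) = \<dots>" .
    have "(CLINT x|M. iexp (a * X x) * complex_of_real (sin (b * Y x))) =
        (CLINT x|M. (iexp (a * X x + b * Y x) - iexp (a * X x + (- b) * Y x)) / (2 * \<i>))"
      by (intro Bochner_Integration.integral_cong refl)
         (simp add: sin_eq exp_add[symmetric] exp_diff algebra_simps field_simps exp_minus)
    also have "\<dots> = ((CLINT x|M. iexp (a * X x + b * Y x)) - (CLINT x|M. iexp (a * X x + (- b) * Y x))) / (2 * \<i>)"
      using int[of a b] int[of a "- b"] by simp
    also have "\<dots> = (CLINT x|M. iexp (a * X x)) * complex_of_real (expectation (\<lambda>x. sin (b * Y x)))"
      unfolding 1 char by (simp only: algebra_simps times_divide_eq_right)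
    finally show "(CLINT x|M. iexp (a * X x) * complex_of_real (sin (b * Y x))) = \<dots>" .
  qed auto
  have EA: "expectation (\<lambda>x. indicator A (X x)) = prob {x \<in> space M. X x \<in> A}"
    by (rule expectation_indicator_comp) measurable
  have iexp_eq: "iexp y = complex_of_real (cos y) + \<i> * complex_of_real (sin y)" for y
    by (simp add: cis_conv_exp[symmetric] complex_eq_iff)
  \<comment> \<open>Now the roles are exchanged: \<open>Ecos\<close> and \<open>Esin\<close> make
    the indicator of \<open>X\<close> in \<open>A\<close> a valid tilt for \<open>Y\<close>.\<close>
  have "expectation (\<lambda>x. indicator B (Y x) * indicator A (X x)) =
     prob {x \<in> space M. Y x \<in> B} * expectation (\<lambda>x. indicator A (X x))"
  proof (rule expectation_indicator_factor)
    fix b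
    have i1: "integrable M (\<lambda>x. indicator A (X x) * cos (b * Y x))"
      and i2: "integrable M (\<lambda>x. indicator A (X x) * sin (b * Y x))"
      by (rule integrable_const_bound[where B = 1]; simp add: indicator_def)+
    have "(CLINT x|M. iexp (b * Y x) * complex_of_real (indicator A (X x))) =
      (CLINT x|M. complex_of_real (indicator A (X x) * cos (b * Y x)) + \<i> * complex_of_real (indicator A (X x) * sin (b * Y x)))"
      by (intro Bochner_Integration.integral_cong refl) (simp only: iexp_eq, simp add: algebra_simps)
    also have "\<dots> = complex_of_real (expectation (\<lambda>x. indicator A (X x) * cos (b * Y x)))
        + \<i> * complex_of_real (expectation (\<lambda>x. indicator A (X x) * sin (b * Y x)))"
      using integrable_of_real[OF i1, where 'a = complex] integrable_of_real[OF i2, where 'a = complex]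
      by (simp del: of_real_mult)
    also have "\<dots> = (complex_of_real (expectation (\<lambda>x. cos (b * Y x))) + \<i> * complex_of_real (expectation (\<lambda>x. sin (b * Y x))))
        * complex_of_real (expectation (\<lambda>x. indicator A (X x)))"
      unfolding Ecos Esin EA by (simp add: algebra_simps)
    also have "complex_of_real (expectation (\<lambda>x. cos (b * Y x))) + \<i> * complex_of_real (expectation (\<lambda>x. sin (b * Y x)))
        = (CLINT x|M. iexp (b * Y x))"
      using integrable_of_real[OF int_cos[of b], where 'a = complex] integrable_of_real[OF int_sin[of b], where 'a = complex]
      unfolding iexp_eq by simp
    finally show "(CLINT x|M. iexp (b * Y x) * complex_of_real (indicator A (X x))) =
      (CLINT x|M. iexp (b * Y x)) * complex_of_real (expectation (\<lambda>x. indicator A (X x)))" .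
  qed (auto simp: indicator_def)
  moreover have "expectation (\<lambda>x. indicator B (Y x) * indicator A (X x) :: real) =
      expectation (indicator {x \<in> space M. X x \<in> A \<and> Y x \<in> B})"
    by (intro Bochner_Integration.integral_cong refl) (auto simp: indicator_def)
  ultimately show ?thesis by (simp add: EA)
qed

section \<open>Gaussian tails\<close>

text \<open>Two-sided and with a strict inequality, so that it measures exactly the failure of
  \<open>\<bar>x\<bar> \<le> t\<close>.\<close>

definition gauss_tail :: "real \<Rightarrow> real" where
  "gauss_tail t = measure std_normal_distribution {x. t < \<bar>x\<bar>}"

interpretation std_normal: real_distribution std_normal_distribution
  by (rule real_dist_normal_dist)

lemma gauss_tail_nonneg: "0 \<le> gauss_tail t"
  by (simp add: gauss_tail_def)

lemma gauss_tail_antimono: "s \<le> t \<Longrightarrow> gauss_tail t \<le> gauss_tail s"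
  unfolding gauss_tail_def by (intro std_normal.finite_measure_mono) auto

text \<open>For \<open>x \<ge> t\<close> the factor \<open>x / t\<close> is at least 1, and
  \<open>x\<close> times the density has an explicit antiderivative. The two tails together give the
  constant \<open>2 / sqrt (2 * pi)\<close>, which is at most 1.\<close>

lemma gauss_tail_le:
  assumes t: "t > 0"
  shows "gauss_tail t \<le> exp (- t\<^sup>2 / 2) / t"
proof -
  let ?\<phi> = "std_normal_density"
  have right: "(\<integral>\<^sup>+x. ennreal (?\<phi> x) * indicator {t..} x \<partial>lborel) \<le> ennreal (?\<phi> t / t)"
  proof -
    have "(\<integral>\<^sup>+x. ennreal (?\<phi> x) * indicator {t..} x \<partial>lborel) \<le>
        (\<integral>\<^sup>+x. ennreal (x / t * ?\<phi> x) * indicator {t..} x \<partial>lborel)"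
    proof (intro nn_integral_mono)
      fix x
      show "ennreal (?\<phi> x) * indicator {t..} x \<le> ennreal (x / t * ?\<phi> x) * indicator {t..} x"
      proof (cases "t \<le> x")
        case True
        then have "1 * ?\<phi> x \<le> x / t * ?\<phi> x"
          using t by (intro mult_right_mono) auto
        then show ?thesis using True by (auto intro: ennreal_leI)
      qed auto
    qed
    also have "\<dots> = ennreal (0 - (- ?\<phi> t / t))"
    proof (rule nn_integral_FTC_atLeast[where F = "\<lambda>x. - ?\<phi> x / t"])
      show "((\<lambda>x. - ?\<phi> x / t) has_real_derivative x / t * ?\<phi> x) (at x)" for x
        unfolding std_normal_density_def using t
        by (auto intro!: derivative_eq_intros simp: field_simps)
      show "((\<lambda>x. - ?\<phi> x / t) \<longlongrightarrow> 0) at_top"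
        unfolding std_normal_density_def using t by real_asymp
    qed (use t in auto)
    finally show ?thesis by simp
  qed
  have left: "(\<integral>\<^sup>+x. ennreal (?\<phi> x) * indicator {..- t} x \<partial>lborel) =
      (\<integral>\<^sup>+x. ennreal (?\<phi> x) * indicator {t..} x \<partial>lborel)"
    by (subst nn_integral_real_affine[where c = "- 1" and t = 0])
       (auto intro!: nn_integral_cong simp: std_normal_density_def indicator_def)
  have "emeasure std_normal_distribution {x. t < \<bar>x\<bar>} =
      (\<integral>\<^sup>+x. ennreal (?\<phi> x) * indicator {x. t < \<bar>x\<bar>} x \<partial>lborel)"
    by (intro emeasure_density) auto
  also have "\<dots> \<le> (\<integral>\<^sup>+x. ennreal (?\<phi> x) * indicator {t..} x + ennreal (?\<phi> x) * indicator {..- t} x \<partial>lborel)"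
    by (intro nn_integral_mono) (auto simp: indicator_def)
  also have "\<dots> = (\<integral>\<^sup>+x. ennreal (?\<phi> x) * indicator {t..} x \<partial>lborel) +
      (\<integral>\<^sup>+x. ennreal (?\<phi> x) * indicator {..- t} x \<partial>lborel)"
    by (intro nn_integral_add) auto
  also have "\<dots> \<le> ennreal (?\<phi> t / t) + ennreal (?\<phi> t / t)"
    unfolding left by (intro add_mono right)
  also have "\<dots> = ennreal (2 * (?\<phi> t / t))"
    using t by (simp flip: ennreal_plus)
  finally have "gauss_tail t \<le> 2 * (?\<phi> t / t)"
    unfolding gauss_tail_def measure_def using t by (intro enn2real_leI) auto
  also have "\<dots> = 2 / sqrt (2 * pi) * (exp (- t\<^sup>2 / 2) / t)"
    by (simp add: std_normal_density_def)
  also have "\<dots> \<le> 1 * (exp (- t\<^sup>2 / 2) / t)"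
  proof (intro mult_right_mono)
    have "2 \<le> sqrt (2 * pi)" using pi_ge_two by (intro real_le_rsqrt) auto
    then show "2 / sqrt (2 * pi) \<le> 1" by simp
  qed (use t in auto)
  finally show ?thesis by simp
qed

text \<open>Only the interval from \<open>t\<close> to \<open>t + 1 / t\<close> is integrated. Its
  length supplies the factor \<open>1 / t\<close>, and the exponential loses at most
  \<open>exp (- 3 / 2)\<close> there, because squaring \<open>t + 1 / t\<close> adds at most 3 to
  the square of \<open>t\<close>.\<close>

lemma gauss_tail_ge:
  assumes t: "t \<ge> 1"
  shows "exp (- 3 / 2) / sqrt (2 * pi) * (exp (- t\<^sup>2 / 2) / t) \<le> gauss_tail t"
proof -
  let ?\<phi> = "std_normal_density"
  have sq: "(t + 1 / t)\<^sup>2 \<le> t\<^sup>2 + 3"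
  proof -
    have "(t + 1 / t)\<^sup>2 = t\<^sup>2 + 2 + (1 / t)\<^sup>2"
      using t by (simp add: power2_eq_square field_simps)
    moreover have "(1 / t)\<^sup>2 \<le> 1"
      using t by (intro power_le_one) auto
    ultimately show ?thesis by simp
  qed
  have low: "?\<phi> (t + 1 / t) \<le> ?\<phi> x" if "t < x" "x \<le> t + 1 / t" for x
  proof -
    have "x\<^sup>2 \<le> (t + 1 / t)\<^sup>2" using that t by (intro power_mono) auto
    then show ?thesis unfolding std_normal_density_def by (intro mult_left_mono) auto
  qed
  have "exp (- 3 / 2) / sqrt (2 * pi) * (exp (- t\<^sup>2 / 2) / t) =
      1 / sqrt (2 * pi) * exp (- (t\<^sup>2 + 3) / 2) * (1 / t)"
    by (simp add: exp_add[symmetric] field_simps)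
  also have "\<dots> \<le> ?\<phi> (t + 1 / t) * (1 / t)"
    unfolding std_normal_density_def using sq t by (intro mult_right_mono mult_left_mono) auto
  finally have "ennreal (exp (- 3 / 2) / sqrt (2 * pi) * (exp (- t\<^sup>2 / 2) / t)) \<le> ennreal (?\<phi> (t + 1 / t) * (1 / t))"
    by (intro ennreal_leI)
  also have "\<dots> = ennreal (?\<phi> (t + 1 / t)) * emeasure lborel {t<..t + 1 / t}"
    using t by (simp flip: ennreal_mult)
  also have "\<dots> = (\<integral>\<^sup>+x. ennreal (?\<phi> (t + 1 / t)) * indicator {t<..t + 1 / t} x \<partial>lborel)"
    by (simp add: nn_integral_cmult_indicator)
  also have "\<dots> \<le> (\<integral>\<^sup>+x. ennreal (?\<phi> x) * indicator {x. t < \<bar>x\<bar>} x \<partial>lborel)"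
    using low t by (intro nn_integral_mono) (auto simp: indicator_def intro!: ennreal_leI)
  also have "\<dots> = emeasure std_normal_distribution {x. t < \<bar>x\<bar>}"
    by (intro emeasure_density[symmetric]) auto
  also have "\<dots> = ennreal (gauss_tail t)"
    unfolding gauss_tail_def by (rule std_normal.emeasure_eq_measure)
  finally show ?thesis
    by (simp add: gauss_tail_nonneg)
qed

section \<open>Tail probabilities of one and of two correlated normal variables\<close>

lemma (in prob_space) prob_abs_gt_of_char:
  assumes X [measurable]: "random_variable borel X"
    and char: "\<And>a. (CLINT x|M. iexp (a * X x)) = complex_of_real (exp (- a\<^sup>2 / 2))"
  shows "prob {x \<in> space M. t < \<bar>X x\<bar>} = gauss_tail t"
proof -
  have "distr M borel X = std_normal_distribution"
  proof (rule Levy_uniqueness)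
    show "Characteristic_Functions.char (distr M borel X) = Characteristic_Functions.char std_normal_distribution"
      by (rule ext) (simp add: char_std_normal_distribution char_def integral_distr char[simplified])
  qed (auto intro: real_dist_normal_dist)
  then have "gauss_tail t = measure (distr M borel X) {x. t < \<bar>x\<bar>}"
    by (simp add: gauss_tail_def)
  also have "\<dots> = prob {x \<in> space M. t < \<bar>X x\<bar>}"
    by (subst measure_distr) (auto intro!: arg_cong[where f = prob])
  finally show ?thesis by simp
qed

text \<open>Chernoff-type bound: on the event one of \<open>X + Y\<close>, \<open>X - Y\<close> exceeds \<open>2 * t\<close> in absolute value.\<close>

lemma (in prob_space) joint_tail_le:
  assumes X [measurable]: "random_variable borel X" and Y [measurable]: "random_variable borel Y"
    and char: "\<And>a b. (CLINT x|M. iexp (a * X x + b * Y x)) =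
                 complex_of_real (exp (- (a\<^sup>2 + 2 * r * a * b + b\<^sup>2) / 2))"
    and r: "\<bar>r\<bar> \<le> \<rho>" and \<rho>: "\<rho> < 1" and t: "t > 0"
  shows "prob {x \<in> space M. t < \<bar>X x\<bar> \<and> t < \<bar>Y x\<bar>} \<le> 2 * gauss_tail (2 * t / sqrt (2 * (1 + \<rho>)))"
proof -
  have tail: "prob {x \<in> space M. 2 * t / sqrt (2 * (1 + \<rho>)) < \<bar>(X x + s * Y x) / sqrt (2 * (1 + s * r))\<bar>}
      = gauss_tail (2 * t / sqrt (2 * (1 + \<rho>)))" if "s = 1 \<or> s = - 1" for s
  proof (rule prob_abs_gt_of_char)
    fix a
    \<comment> \<open>\<open>q\<close> is the standard deviation of \<open>X + s * Y\<close>,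
      nonzero because \<open>\<bar>r\<bar> < 1\<close>.\<close>
    define q where "q = sqrt (2 * (1 + s * r))"
    have q: "q\<^sup>2 = 2 * (1 + s * r)" "q \<noteq> 0"
      using r \<rho> that by (auto simp: q_def)
    have "(a / q)\<^sup>2 + 2 * r * (a / q) * (a * s / q) + (a * s / q)\<^sup>2 = (a / q)\<^sup>2 * (1 + 2 * s * r + s\<^sup>2)"
      by (simp add: power2_eq_square algebra_simps)
    also have "\<dots> = a\<^sup>2"
      using q that by (auto simp: power_divide)
    finally have sq: "(a / q)\<^sup>2 + 2 * r * (a / q) * (a * s / q) + (a * s / q)\<^sup>2 = a\<^sup>2" .
    have "a * ((X x + s * Y x) / q) = (a / q) * X x + (a * s / q) * Y x" for x
      by (simp add: add_divide_distrib distrib_left)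
    then show "(CLINT x|M. iexp (a * ((X x + s * Y x) / sqrt (2 * (1 + s * r))))) = complex_of_real (exp (- a\<^sup>2 / 2))"
      using char[of "a / q" "a * s / q"] unfolding sq q_def[symmetric] by (simp only:)
  qed measurable
  have "prob {x \<in> space M. t < \<bar>X x\<bar> \<and> t < \<bar>Y x\<bar>} \<le>
      prob ({x \<in> space M. 2 * t / sqrt (2 * (1 + \<rho>)) < \<bar>(X x + 1 * Y x) / sqrt (2 * (1 + 1 * r))\<bar>} \<union>
        {x \<in> space M. 2 * t / sqrt (2 * (1 + \<rho>)) < \<bar>(X x + (-1) * Y x) / sqrt (2 * (1 + (-1) * r))\<bar>})"
  proof (rule finite_measure_mono)
    \<comment> \<open>The standard deviation of \<open>X + Y\<close> or \<open>X - Y\<close> is at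
      most \<open>sqrt (2 * (1 + \<rho>))\<close>, so one cutoff serves both signs and every
      \<open>r\<close> in the range.\<close>
    have *: "2 * t / sqrt (2 * (1 + \<rho>)) < \<bar>z / sqrt (2 * (1 + u))\<bar>" if "2 * t < \<bar>z\<bar>" "\<bar>u\<bar> = \<bar>r\<bar>" for z u
    proof -
      have "2 * t / sqrt (2 * (1 + \<rho>)) \<le> 2 * t / sqrt (2 * (1 + u))"
        using t that r \<rho> by (intro divide_left_mono) auto
      also have "\<dots> < \<bar>z\<bar> / sqrt (2 * (1 + u))"
        using that r \<rho> by (intro divide_strict_right_mono) auto
      finally show ?thesis using that r \<rho> by (simp add: abs_divide)
    qed
    show "{x \<in> space M. t < \<bar>X x\<bar> \<and> t < \<bar>Y x\<bar>} \<subseteq>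
      {x \<in> space M. 2 * t / sqrt (2 * (1 + \<rho>)) < \<bar>(X x + 1 * Y x) / sqrt (2 * (1 + 1 * r))\<bar>} \<union>
        {x \<in> space M. 2 * t / sqrt (2 * (1 + \<rho>)) < \<bar>(X x + (-1) * Y x) / sqrt (2 * (1 + (-1) * r))\<bar>}"
    proof
      fix x assume x: "x \<in> {x \<in> space M. t < \<bar>X x\<bar> \<and> t < \<bar>Y x\<bar>}"
      then have "2 * t < \<bar>X x + 1 * Y x\<bar> \<or> 2 * t < \<bar>X x + (-1) * Y x\<bar>" by auto
      with x *[of "X x + 1 * Y x" "1 * r"] *[of "X x + (-1) * Y x" "(-1) * r"]
      show "x \<in> {x \<in> space M. 2 * t / sqrt (2 * (1 + \<rho>)) < \<bar>(X x + 1 * Y x) / sqrt (2 * (1 + 1 * r))\<bar>} \<union>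
        {x \<in> space M. 2 * t / sqrt (2 * (1 + \<rho>)) < \<bar>(X x + (-1) * Y x) / sqrt (2 * (1 + (-1) * r))\<bar>}"
        by auto
    qed
  qed measurable
  also have "\<dots> \<le> 2 * gauss_tail (2 * t / sqrt (2 * (1 + \<rho>)))"
    by (rule order_trans[OF measure_Un_le]) (use tail[of 1] tail[of "- 1"] in simp_all)
  finally show ?thesis .
qed

text \<open>Writing \<open>Y = r * X + sqrt (1 - r\<^sup>2) * W\<close> with \<open>W\<close> independent of \<open>X\<close>, the event forces
  \<open>2 * t < \<bar>X\<bar>\<close> or \<open>t * (1 - 2 * \<bar>r\<bar>) < \<bar>W\<bar>\<close>.\<close>

lemma (in prob_space) joint_tail_le_almost_indep:
  assumes X [measurable]: "random_variable borel X" and Y [measurable]: "random_variable borel Y"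
    and char: "\<And>a b. (CLINT x|M. iexp (a * X x + b * Y x)) =
                 complex_of_real (exp (- (a\<^sup>2 + 2 * r * a * b + b\<^sup>2) / 2))"
    and r: "\<bar>r\<bar> \<le> 1 / 2" and t: "t > 0"
  shows "prob {x \<in> space M. t < \<bar>X x\<bar> \<and> t < \<bar>Y x\<bar>} \<le>
           gauss_tail (2 * t) + gauss_tail t * gauss_tail (t * (1 - 2 * \<bar>r\<bar>))"
proof -
  \<comment> \<open>\<open>q\<close> is the standard deviation of the residual
    \<open>Y - r * X\<close>, so that \<open>W\<close> is standard normal. As
    \<open>q \<le> 1\<close>, a lower bound on the residual passes to \<open>W\<close>.\<close>
  define q where "q = sqrt (1 - r\<^sup>2)"
  have r2: "r\<^sup>2 < 1"
    using r by (subst abs_square_less_1) auto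
  then have q: "q\<^sup>2 = 1 - r\<^sup>2" "q > 0" "q \<le> 1"
    by (auto simp: q_def)
  define W where "W x = (Y x - r * X x) / q" for x
  have [measurable]: "random_variable borel W" unfolding W_def by measurable
  have charW: "(CLINT x|M. iexp (a * X x + b * W x)) = complex_of_real (exp (- (a\<^sup>2 + b\<^sup>2) / 2))" for a b
  proof -
    have "a * X x + b * W x = (a - b * r / q) * X x + (b / q) * Y x" for x
      using q by (simp add: W_def field_simps)
    then have "(CLINT x|M. iexp (a * X x + b * W x)) =
        complex_of_real (exp (- ((a - b * r / q)\<^sup>2 + 2 * r * (a - b * r / q) * (b / q) + (b / q)\<^sup>2) / 2))"
      by (simp only: char)
    also have "(a - b * r / q)\<^sup>2 + 2 * r * (a - b * r / q) * (b / q) + (b / q)\<^sup>2 = a\<^sup>2 + (b / q)\<^sup>2 * (1 - r\<^sup>2)"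
      by (simp add: power2_eq_square algebra_simps diff_divide_distrib)
    also have "(b / q)\<^sup>2 * (1 - r\<^sup>2) = b\<^sup>2"
      unfolding q(1)[symmetric] using q(2) by (simp add: power_divide)
    finally show ?thesis .
  qed
  have charX1: "(CLINT x|M. iexp (a * X x)) = complex_of_real (exp (- a\<^sup>2 / 2))" for a
    using charW[of a 0] by simp
  have charW1: "(CLINT x|M. iexp (b * W x)) = complex_of_real (exp (- b\<^sup>2 / 2))" for b
    using charW[of 0 b] by simp
  have "prob {x \<in> space M. X x \<in> {x. t < \<bar>x\<bar>} \<and> W x \<in> {x. t * (1 - 2 * \<bar>r\<bar>) < \<bar>x\<bar>}} =
     prob {x \<in> space M. X x \<in> {x. t < \<bar>x\<bar>}} * prob {x \<in> space M. W x \<in> {x. t * (1 - 2 * \<bar>r\<bar>) < \<bar>x\<bar>}}"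
  proof (rule prob_factor_of_char_factor)
    show "(CLINT x|M. iexp (a * X x + b * W x)) = (CLINT x|M. iexp (a * X x)) * (CLINT x|M. iexp (b * W x))" for a b
      unfolding charW charX1 charW1 by (simp flip: of_real_mult exp_add add: field_simps)
  qed measurable
  also have "\<dots> = gauss_tail t * gauss_tail (t * (1 - 2 * \<bar>r\<bar>))"
    using prob_abs_gt_of_char[OF X charX1] prob_abs_gt_of_char[OF _ charW1] by simp
  finally have indep: "prob {x \<in> space M. t < \<bar>X x\<bar> \<and> t * (1 - 2 * \<bar>r\<bar>) < \<bar>W x\<bar>} = \<dots>"
    by simp
  have "prob {x \<in> space M. t < \<bar>X x\<bar> \<and> t < \<bar>Y x\<bar>} \<le>
      prob ({x \<in> space M. 2 * t < \<bar>X x\<bar>} \<union> {x \<in> space M. t < \<bar>X x\<bar> \<and> t * (1 - 2 * \<bar>r\<bar>) < \<bar>W x\<bar>})"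
  proof (rule finite_measure_mono)
    have "t * (1 - 2 * \<bar>r\<bar>) < \<bar>W x\<bar>" if "\<bar>X x\<bar> \<le> 2 * t" "t < \<bar>Y x\<bar>" for x
    proof -
      have "\<bar>r * X x\<bar> \<le> \<bar>r\<bar> * (2 * t)"
        unfolding abs_mult using that by (intro mult_left_mono) auto
      moreover have "\<bar>Y x - r * X x\<bar> \<ge> \<bar>Y x\<bar> - \<bar>r * X x\<bar>" by simp
      ultimately have "t * (1 - 2 * \<bar>r\<bar>) < \<bar>Y x - r * X x\<bar>"
        using that by (simp add: algebra_simps)
      also have "\<dots> = q * \<bar>W x\<bar>"
        using q by (simp add: W_def abs_divide)
      also have "\<dots> \<le> 1 * \<bar>W x\<bar>"
        using q by (intro mult_right_mono) auto
      finally show ?thesis by simp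
    qed
    then show "{x \<in> space M. t < \<bar>X x\<bar> \<and> t < \<bar>Y x\<bar>} \<subseteq>
      {x \<in> space M. 2 * t < \<bar>X x\<bar>} \<union> {x \<in> space M. t < \<bar>X x\<bar> \<and> t * (1 - 2 * \<bar>r\<bar>) < \<bar>W x\<bar>}"
      by (auto simp: not_less)
  qed measurable
  also have "\<dots> \<le> prob {x \<in> space M. 2 * t < \<bar>X x\<bar>} + prob {x \<in> space M. t < \<bar>X x\<bar> \<and> t * (1 - 2 * \<bar>r\<bar>) < \<bar>W x\<bar>}"
    by (intro measure_Un_le) measurable
  finally show ?thesis
    using prob_abs_gt_of_char[OF X charX1] indep by simp
qed

text \<open>Second moment method: integrate \<open>2 * c * S - (c * S)\<^sup>2 \<le> 1\<close> for the number \<open>S\<close> of events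
  that occur.\<close>

lemma (in prob_space) prob_Union_ge_second_moment:
  assumes fin: "finite I" and A [measurable]: "\<And>i. i \<in> I \<Longrightarrow> A i \<in> events"
  shows "2 * c * (\<Sum>i\<in>I. prob (A i)) - c\<^sup>2 * (\<Sum>i\<in>I. \<Sum>j\<in>I. prob (A i \<inter> A j)) \<le> prob (\<Union>i\<in>I. A i)"
proof -
  have [measurable]: "(\<Union>i\<in>I. A i) \<in> events" using fin A by auto
  have AA [measurable]: "A i \<inter> A j \<in> events" if "i \<in> I" "j \<in> I" for i j
    using that A by auto
  define S where "S x = (\<Sum>i\<in>I. indicator (A i) x :: real)" for x
  have S2: "(S x)\<^sup>2 = (\<Sum>i\<in>I. \<Sum>j\<in>I. indicator (A i \<inter> A j) x)" for x
    by (simp add: S_def power2_eq_square sum_product indicator_inter_arith)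
  have int1: "integrable M S"
    unfolding S_def using A by (intro Bochner_Integration.integrable_sum) (simp add: emeasure_eq_measure)
  have int2: "integrable M (\<lambda>x. (S x)\<^sup>2)"
    unfolding S2 using AA by (intro Bochner_Integration.integrable_sum) (simp add: emeasure_eq_measure)
  have E1: "expectation S = (\<Sum>i\<in>I. prob (A i))"
    unfolding S_def using A by (subst Bochner_Integration.integral_sum) (auto simp: emeasure_eq_measure)
  have E2: "expectation (\<lambda>x. (S x)\<^sup>2) = (\<Sum>i\<in>I. \<Sum>j\<in>I. prob (A i \<inter> A j))"
    unfolding S2 using AA by (subst Bochner_Integration.integral_sum, simp add: emeasure_eq_measure Bochner_Integration.integrable_sum)
      (intro sum.cong refl, subst Bochner_Integration.integral_sum, auto simp: emeasure_eq_measure)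
  have "2 * c * expectation S - c\<^sup>2 * expectation (\<lambda>x. (S x)\<^sup>2) = expectation (\<lambda>x. 2 * c * S x - c\<^sup>2 * (S x)\<^sup>2)"
    using int1 int2 by simp
  also have "\<dots> \<le> expectation (indicator (\<Union>i\<in>I. A i))"
  proof (rule integral_mono)
    fix x
    show "2 * c * S x - c\<^sup>2 * (S x)\<^sup>2 \<le> indicator (\<Union>i\<in>I. A i) x"
    proof (cases "x \<in> (\<Union>i\<in>I. A i)")
      case True
      have "0 \<le> (1 - c * S x)\<^sup>2" by simp
      then show ?thesis using True by (simp add: power2_eq_square algebra_simps)
    next
      case False
      then have "S x = 0" unfolding S_def by (intro sum.neutral) auto
      then show ?thesis by simp
    qed
  qed (use int1 int2 in \<open>auto simp: emeasure_eq_measure\<close>)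
  finally show ?thesis by (simp add: E1 E2)
qed

section \<open>Frames and Gaussian vectors\<close>

text \<open>Elimination, one element of \<open>\<Omega>\<close> at a time: solving for a coordinate
  \<open>k\<close> where \<open>\<phi> w\<close> is nonzero removes one equation and one unknown,
  which keeps the strict inequality of cardinalities.\<close>

lemma exists_nonzero_orthogonal:
  fixes \<phi> :: "'w \<Rightarrow> 'i \<Rightarrow> real"
  assumes "finite \<Omega>" "finite I" "card \<Omega> < card I"
  shows "\<exists>u. (\<exists>k\<in>I. u k \<noteq> 0) \<and> (\<forall>\<omega>\<in>\<Omega>. inner_on I (\<phi> \<omega>) u = 0)"
  using assms
proof (induction \<Omega> arbitrary: I \<phi> rule: finite_induct)
  case empty
  then obtain k where "k \<in> I" by fastforce
  then show ?case by (intro exI[of _ "\<lambda>_. 1"]) auto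
next
  case (insert w \<Omega>)
  show ?case
  proof (cases "\<exists>k\<in>I. \<phi> w k \<noteq> 0")
    case False
    have "\<exists>u. (\<exists>k\<in>I. u k \<noteq> 0) \<and> (\<forall>\<omega>\<in>\<Omega>. inner_on I (\<phi> \<omega>) u = 0)"
      by (rule insert.IH) (use insert.hyps insert.prems in auto)
    then obtain u where u: "\<exists>k\<in>I. u k \<noteq> 0" "\<forall>\<omega>\<in>\<Omega>. inner_on I (\<phi> \<omega>) u = 0"
      by blast
    from False have "inner_on I (\<phi> w) u = 0" by (simp add: inner_on_def)
    with u show ?thesis by auto
  next
    case True
    then obtain k where k: "k \<in> I" "\<phi> w k \<noteq> 0" by auto
    define J where "J = I - {k}"
    have J: "finite J" "I = insert k J" "k \<notin> J" using k insert by (auto simp: J_def)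
    \<comment> \<open>A multiple of \<open>\<phi> w\<close> is subtracted so that the entry at
      \<open>k\<close> vanishes; the reduced system lives on \<open>J\<close>.\<close>
    define \<psi> where "\<psi> \<omega> j = \<phi> \<omega> j - \<phi> \<omega> k / \<phi> w k * \<phi> w j" for \<omega> j
    have "card \<Omega> < card J" using insert J by simp
    with insert.IH[OF \<open>finite J\<close>, of \<psi>] obtain v where v: "\<exists>j\<in>J. v j \<noteq> 0" "\<forall>\<omega>\<in>\<Omega>. inner_on J (\<psi> \<omega>) v = 0"
      by auto
    \<comment> \<open>The value at \<open>k\<close> is forced by orthogonality to
      \<open>\<phi> w\<close>.\<close>
    define u where "u = v(k := - inner_on J (\<phi> w) v / \<phi> w k)"
    have inner: "inner_on I (\<phi> \<omega>) u = inner_on J (\<phi> \<omega>) v - \<phi> \<omega> k / \<phi> w k * inner_on J (\<phi> w) v" for \<omega>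
    proof -
      have "inner_on J (\<phi> \<omega>) u = inner_on J (\<phi> \<omega>) v"
        unfolding inner_on_def using J by (intro sum.cong) (auto simp: u_def)
      then show ?thesis using J by (simp add: inner_on_def u_def)
    qed
    have "inner_on J (\<psi> \<omega>) v = inner_on J (\<phi> \<omega>) v - \<phi> \<omega> k / \<phi> w k * inner_on J (\<phi> w) v" for \<omega>
      by (simp add: inner_on_def \<psi>_def left_diff_distrib sum_subtractf sum_distrib_left mult.assoc)
    with v inner have "\<forall>\<omega>\<in>insert w \<Omega>. inner_on I (\<phi> \<omega>) u = 0"
      using k by auto
    moreover have "\<exists>j\<in>I. u j \<noteq> 0" using v J by (auto simp: u_def)
    ultimately show ?thesis by blast
  qed
qed

lemma L2_set_power2: "(L2_set u I)\<^sup>2 = inner_on I u u"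
  by (simp add: L2_set_def inner_on_def sum_nonneg power2_eq_square)

text \<open>Fewer elements would leave a nonzero vector orthogonal to all of them, against the lower
  frame inequality.\<close>

lemma card_le_card_of_is_frame:
  assumes "is_frame I \<Omega> \<phi>" "finite I"
  shows "card I \<le> card \<Omega>"
proof (rule ccontr)
  assume "\<not> card I \<le> card \<Omega>"
  moreover have "finite \<Omega>" using assms by (simp add: is_frame_def)
  ultimately obtain u where u: "\<exists>k\<in>I. u k \<noteq> 0" "\<forall>\<omega>\<in>\<Omega>. inner_on I (\<phi> \<omega>) u = 0"
    using exists_nonzero_orthogonal[of \<Omega> I \<phi>] assms by auto
  from assms obtain a where "a > 0" and le: "a * (L2_set u I)\<^sup>2 \<le> (\<Sum>\<omega>\<in>\<Omega>. \<bar>inner_on I (\<phi> \<omega>) u\<bar>\<^sup>2)"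
    unfolding is_frame_def by blast
  from le u(2) have "a * (L2_set u I)\<^sup>2 \<le> 0" by simp
  with \<open>a > 0\<close> have "(L2_set u I)\<^sup>2 \<le> 0"
    by (simp add: mult_le_0_iff)
  then have "(\<Sum>k\<in>I. u k * u k) = 0"
    by (simp add: L2_set_power2 inner_on_def order_antisym sum_nonneg)
  then show False
    using u(1) assms(2) by (simp add: sum_nonneg_eq_0_iff)
qed

lemma finite_grid [simp]: "finite (grid d n)"
  by (auto simp: grid_def intro: finite_PiE)

lemma card_grid: "card (grid d n) = n ^ d"
  by (simp add: grid_def card_PiE)

text \<open>The upper frame inequality is tested with \<open>u = \<phi> \<omega>\<close>, which has
  norm 1; every admissible constant then bounds the sum, and so does their infimum. This limits how
  many elements can correlate noticeably with a given one.\<close>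

lemma sum_inner_power2_le_upper_frame_bound:
  assumes "is_frame I \<Omega> \<phi>" "normalized I \<Omega> \<phi>" "\<omega> \<in> \<Omega>"
  shows "(\<Sum>\<omega>'\<in>\<Omega>. (inner_on I (\<phi> \<omega>) (\<phi> \<omega>'))\<^sup>2) \<le> upper_frame_bound I \<Omega> \<phi>"
  unfolding upper_frame_bound_def
proof (rule cInf_greatest)
  show "{b. \<forall>u. (\<Sum>\<omega>\<in>\<Omega>. \<bar>inner_on I (\<phi> \<omega>) u\<bar>\<^sup>2) \<le> b * (L2_set u I)\<^sup>2} \<noteq> {}"
    using assms(1) unfolding is_frame_def by blast
  fix b assume "b \<in> {b. \<forall>u. (\<Sum>\<omega>\<in>\<Omega>. \<bar>inner_on I (\<phi> \<omega>) u\<bar>\<^sup>2) \<le> b * (L2_set u I)\<^sup>2}"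
  then have "(\<Sum>\<omega>'\<in>\<Omega>. \<bar>inner_on I (\<phi> \<omega>') (\<phi> \<omega>)\<bar>\<^sup>2) \<le> b * (L2_set (\<phi> \<omega>) I)\<^sup>2" by blast
  also have "(L2_set (\<phi> \<omega>) I)\<^sup>2 = 1" using assms by (simp add: normalized_def)
  finally show "(\<Sum>\<omega>'\<in>\<Omega>. (inner_on I (\<phi> \<omega>) (\<phi> \<omega>'))\<^sup>2) \<le> b"
    by (simp add: inner_on_def mult.commute)
qed

section \<open>Characteristic functions of the coefficients of Gaussian noise\<close>

lemma (in prob_space) char_normal:
  assumes X: "distributed M lborel X (normal_density 0 \<sigma>)" and \<sigma>: "\<sigma> > 0"
  shows "(CLINT x|M. iexp (a * X x)) = complex_of_real (exp (- (\<sigma> * a)\<^sup>2 / 2))"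
proof -
  have "distributed M lborel (\<lambda>x. 0 + 1 / \<sigma> * X x) (normal_density (0 + 1 / \<sigma> * 0) (\<bar>1 / \<sigma>\<bar> * \<sigma>))"
    using \<sigma> by (intro normal_density_affine X) auto
  then have D: "distributed M lborel (\<lambda>x. X x / \<sigma>) std_normal_density"
    using \<sigma> by simp
  then have [measurable]: "random_variable borel (\<lambda>x. X x / \<sigma>)"
    using distributed_measurable[OF D] by simp
  have "distr M borel (\<lambda>x. X x / \<sigma>) = std_normal_distribution"
    using distributed_distr_eq_density[OF D] by (simp cong: distr_cong)
  then have "Characteristic_Functions.char (distr M borel (\<lambda>x. X x / \<sigma>)) (\<sigma> * a) = complex_of_real (exp (- (\<sigma> * a)\<^sup>2 / 2))"
    by (simp add: char_std_normal_distribution)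
  also have "Characteristic_Functions.char (distr M borel (\<lambda>x. X x / \<sigma>)) (\<sigma> * a) = (CLINT x|M. iexp (\<sigma> * a * (X x / \<sigma>)))"
    unfolding char_def by (subst integral_distr) auto
  also have "\<dots> = (CLINT x|M. iexp (a * X x))"
    using \<sigma> by (intro Bochner_Integration.integral_cong refl) simp
  finally show ?thesis .
qed

text \<open>By independence the characteristic function of the sum at 1 is a product over
  \<open>k\<close>, and the exponents of the factors add up to minus half the squared norm of
  \<open>u\<close>.\<close>

lemma (in prob_space) char_inner_on_gaussian:
  assumes indep: "indep_vars (\<lambda>_. borel) X I" and "finite I" and \<sigma>: "\<sigma> > 0"
    and X: "\<And>k. k \<in> I \<Longrightarrow> distributed M lborel (X k) (normal_density 0 \<sigma>)"
  shows "(CLINT x|M. iexp (inner_on I u (\<lambda>k. X k x) / \<sigma>)) = complex_of_real (exp (- inner_on I u u / 2))"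
proof -
  have rv: "random_variable borel (X k)" if "k \<in> I" for k
    using indep that unfolding indep_vars_def by blast
  have indep': "indep_vars (\<lambda>_. borel) (\<lambda>k x. u k / \<sigma> * X k x) I"
    by (rule indep_vars_compose2[OF indep]) auto
  have rv': "random_variable borel (\<lambda>x. u k / \<sigma> * X k x)" if "k \<in> I" for k
    using indep' that unfolding indep_vars_def by blast
  have "(CLINT x|M. iexp (inner_on I u (\<lambda>k. X k x) / \<sigma>)) =
      Characteristic_Functions.char (distr M borel (\<lambda>x. \<Sum>k\<in>I. u k / \<sigma> * X k x)) 1"
    unfolding char_def inner_on_def
    by (subst integral_distr) (use rv' in \<open>auto simp: sum_divide_distrib\<close>)
  also have "\<dots> = (\<Prod>k\<in>I. Characteristic_Functions.char (distr M borel (\<lambda>x. u k / \<sigma> * X k x)) 1)"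
    by (rule char_distr_sum[OF indep'])
  also have "\<dots> = (\<Prod>k\<in>I. complex_of_real (exp (- (u k)\<^sup>2 / 2)))"
  proof (intro prod.cong refl)
    fix k assume k: "k \<in> I"
    have "Characteristic_Functions.char (distr M borel (\<lambda>x. u k / \<sigma> * X k x)) 1 = (CLINT x|M. iexp (1 * (u k / \<sigma> * X k x)))"
      unfolding char_def by (subst integral_distr) (use rv'[OF k] in auto)
    also have "\<dots> = complex_of_real (exp (- (\<sigma> * (u k / \<sigma>))\<^sup>2 / 2))"
      unfolding mult_1 by (rule char_normal[OF X[OF k] \<sigma>])
    finally show "Characteristic_Functions.char (distr M borel (\<lambda>x. u k / \<sigma> * X k x)) 1 = complex_of_real (exp (- (u k)\<^sup>2 / 2))"
      using \<sigma> by simp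
  qed
  also have "\<dots> = complex_of_real (exp (\<Sum>k\<in>I. - (u k)\<^sup>2 / 2))"
    using \<open>finite I\<close> by (simp add: exp_sum)
  also have "(\<Sum>k\<in>I. - (u k)\<^sup>2 / 2) = - inner_on I u u / 2"
    by (simp add: inner_on_def sum_negf sum_divide_distrib power2_eq_square)
  finally show ?thesis .
qed

lemma inner_on_commute: "inner_on I u v = inner_on I v u"
  by (simp add: inner_on_def mult.commute)

lemma inner_on_add_left:
  "inner_on I (\<lambda>k. a * u k + b * v k) w = a * inner_on I u w + b * inner_on I v w"
  by (simp add: inner_on_def sum.distrib sum_distrib_left algebra_simps)

text \<open>The noise at one fixed \<open>n\<close>; all estimates in this context are
  nonasymptotic.\<close>

locale gaussian_vector = prob_space M for M :: "'a measure" +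
  fixes I :: "'i set" and X :: "'i \<Rightarrow> 'a \<Rightarrow> real" and \<sigma> :: real
  assumes fin_I: "finite I" and \<sigma>: "\<sigma> > 0"
    and indep: "indep_vars (\<lambda>_. borel) X I"
    and normal: "\<And>k. k \<in> I \<Longrightarrow> distributed M lborel (X k) (normal_density 0 \<sigma>)"
begin

text \<open>The division by \<open>\<sigma>\<close> makes the coefficient of a unit vector standard
  normal.\<close>

definition coeff :: "('i \<Rightarrow> real) \<Rightarrow> 'a \<Rightarrow> real" where
  "coeff u x = inner_on I u (\<lambda>k. X k x) / \<sigma>"

lemma measurable_coeff [measurable]: "random_variable borel (coeff u)"
proof -
  have "random_variable borel (X k)" if "k \<in> I" for k
    using indep that unfolding indep_vars_def by blast
  then show ?thesis unfolding coeff_def inner_on_def by measurable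
qed

lemma char_coeff: "(CLINT x|M. iexp (coeff u x)) = complex_of_real (exp (- inner_on I u u / 2))"
  unfolding coeff_def by (rule char_inner_on_gaussian[OF indep fin_I \<sigma> normal])

text \<open>A linear combination of coefficients is the coefficient of the combined vector, so the
  pair is bivariate normal with the inner product as correlation.\<close>

lemma char_coeff2:
  assumes "inner_on I u u = 1" "inner_on I v v = 1"
  shows "(CLINT x|M. iexp (a * coeff u x + b * coeff v x)) =
    complex_of_real (exp (- (a\<^sup>2 + 2 * inner_on I u v * a * b + b\<^sup>2) / 2))"
proof -
  let ?w = "\<lambda>k. a * u k + b * v k"
  have "a * coeff u x + b * coeff v x = coeff ?w x" for x
    by (simp add: coeff_def inner_on_add_left add_divide_distrib)
  then have "(CLINT x|M. iexp (a * coeff u x + b * coeff v x)) = (CLINT x|M. iexp (coeff ?w x))"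
    by simp
  also have "\<dots> = complex_of_real (exp (- inner_on I ?w ?w / 2))"
    by (rule char_coeff)
  also have "inner_on I ?w ?w = a * inner_on I ?w u + b * inner_on I ?w v"
    by (simp add: inner_on_add_left inner_on_commute[of _ _ ?w])
  also have "\<dots> = a\<^sup>2 + 2 * inner_on I u v * a * b + b\<^sup>2"
    using assms by (simp add: inner_on_add_left inner_on_commute[of _ v u] power2_eq_square algebra_simps)
  finally show ?thesis .
qed

lemma prob_coeff_gt:
  assumes "inner_on I u u = 1"
  shows "prob {x \<in> space M. t < \<bar>coeff u x\<bar>} = gauss_tail t"
proof (rule prob_abs_gt_of_char)
  show "(CLINT x|M. iexp (a * coeff u x)) = complex_of_real (exp (- a\<^sup>2 / 2))" for a
    using char_coeff2[OF assms assms, of a 0] by simp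
qed measurable

lemma prob_max_norm_le:
  assumes \<Omega>: "finite \<Omega>" "\<Omega> \<noteq> {}"
  shows "prob {x \<in> space M. max_norm \<Omega> (analysis_op I \<phi> (\<lambda>k. X k x)) \<le> \<sigma> * t} =
    1 - prob (\<Union>\<omega>\<in>\<Omega>. {x \<in> space M. t < \<bar>coeff (\<phi> \<omega>) x\<bar>})"
proof -
  have "max_norm \<Omega> (analysis_op I \<phi> (\<lambda>k. X k x)) \<le> \<sigma> * t \<longleftrightarrow> (\<forall>\<omega>\<in>\<Omega>. \<bar>coeff (\<phi> \<omega>) x\<bar> \<le> t)" for x
    using \<Omega> \<sigma> by (simp add: max_norm_def analysis_op_def coeff_def abs_divide field_simps)
  then have "{x \<in> space M. max_norm \<Omega> (analysis_op I \<phi> (\<lambda>k. X k x)) \<le> \<sigma> * t} =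
      space M - (\<Union>\<omega>\<in>\<Omega>. {x \<in> space M. t < \<bar>coeff (\<phi> \<omega>) x\<bar>})"
    by (auto simp: not_less)
  also have "prob \<dots> = 1 - prob (\<Union>\<omega>\<in>\<Omega>. {x \<in> space M. t < \<bar>coeff (\<phi> \<omega>) x\<bar>})"
    using \<Omega> by (intro prob_compl sets.finite_UN) auto
  finally show ?thesis .
qed

text \<open>Union bound over the frame elements.\<close>

lemma prob_max_norm_ge:
  assumes \<Omega>: "finite \<Omega>" "\<Omega> \<noteq> {}" and unit: "\<And>\<omega>. \<omega> \<in> \<Omega> \<Longrightarrow> inner_on I (\<phi> \<omega>) (\<phi> \<omega>) = 1"
  shows "1 - real (card \<Omega>) * gauss_tail t \<le>
    prob {x \<in> space M. max_norm \<Omega> (analysis_op I \<phi> (\<lambda>k. X k x)) \<le> \<sigma> * t}"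
proof -
  have "prob (\<Union>\<omega>\<in>\<Omega>. {x \<in> space M. t < \<bar>coeff (\<phi> \<omega>) x\<bar>}) \<le> (\<Sum>\<omega>\<in>\<Omega>. prob {x \<in> space M. t < \<bar>coeff (\<phi> \<omega>) x\<bar>})"
    using \<Omega> by (intro finite_measure_subadditive_finite) auto
  also have "\<dots> = real (card \<Omega>) * gauss_tail t"
    using unit by (simp add: prob_coeff_gt)
  finally show ?thesis using \<Omega> by (simp add: prob_max_norm_le)
qed

text \<open>Three ranges of the correlation \<open>r\<close>. For large ones a single tail bounds
  the joint event. In the middle range a factor \<open>r^2 / \<delta>^2 \<ge> 1\<close> is inserted,
  so that summing over pairs brings in the frame bound. Small correlations are almost
  independent.\<close>

lemma prob_joint_coeff_gt:
  assumes u: "inner_on I u u = 1" and v: "inner_on I v v = 1"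
    and \<rho>: "\<rho> < 1" and \<delta>: "0 < \<delta>" "\<delta> \<le> 1 / 2" and t: "t > 0"
  shows "prob ({x \<in> space M. t < \<bar>coeff u x\<bar>} \<inter> {x \<in> space M. t < \<bar>coeff v x\<bar>}) \<le>
    (if \<bar>inner_on I u v\<bar> \<ge> \<rho> then gauss_tail t else 0) +
    (inner_on I u v)\<^sup>2 * (2 * gauss_tail (2 * t / sqrt (2 * (1 + \<rho>))) / \<delta>\<^sup>2) +
    (gauss_tail (2 * t) + gauss_tail t * gauss_tail (t * (1 - 2 * \<delta>)))"
    (is "?P \<le> ?A + ?r\<^sup>2 * (2 * ?G / \<delta>\<^sup>2) + ?C")
proof -
  have P: "?P = prob {x \<in> space M. t < \<bar>coeff u x\<bar> \<and> t < \<bar>coeff v x\<bar>}"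
    by (intro arg_cong[where f = prob]) auto
  have nn: "?A \<ge> 0" "?r\<^sup>2 * (2 * ?G / \<delta>\<^sup>2) \<ge> 0" "?C \<ge> 0"
    by (auto simp: gauss_tail_nonneg)
  consider "\<rho> \<le> \<bar>?r\<bar>" | "\<bar>?r\<bar> < \<rho>" "\<delta> \<le> \<bar>?r\<bar>" | "\<bar>?r\<bar> < \<delta>" by linarith
  then show ?thesis
  proof cases
    case 1
    have "?P \<le> prob {x \<in> space M. t < \<bar>coeff u x\<bar>}"
      by (intro finite_measure_mono) auto
    with 1 nn show ?thesis by (simp add: prob_coeff_gt[OF u])
  next
    case 2
    have "?P \<le> 2 * ?G"
      unfolding P using 2 \<rho> t by (intro joint_tail_le[OF _ _ char_coeff2[OF u v]]) auto
    also have "\<dots> \<le> ?r\<^sup>2 / \<delta>\<^sup>2 * (2 * ?G)"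
    proof -
      have "\<delta>\<^sup>2 \<le> \<bar>?r\<bar>\<^sup>2" using 2 \<delta> by (intro power_mono) auto
      then have "1 \<le> ?r\<^sup>2 / \<delta>\<^sup>2" using \<delta> by simp
      then have "1 * (2 * ?G) \<le> ?r\<^sup>2 / \<delta>\<^sup>2 * (2 * ?G)"
        by (intro mult_right_mono) (simp_all add: gauss_tail_nonneg)
      then show ?thesis by simp
    qed
    finally show ?thesis using nn by simp
  next
    case 3
    have "?P \<le> gauss_tail (2 * t) + gauss_tail t * gauss_tail (t * (1 - 2 * \<bar>?r\<bar>))"
      unfolding P using 3 \<delta> t by (intro joint_tail_le_almost_indep[OF _ _ char_coeff2[OF u v]]) auto
    also have "\<dots> \<le> ?C"
      using 3 t by (intro add_mono order_refl mult_left_mono gauss_tail_antimono gauss_tail_nonneg) auto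
    finally show ?thesis using nn by simp
  qed
qed

text \<open>The pair bounds are summed and fed into the second moment inequality, with
  \<open>c\<close> and \<open>\<delta>\<close> left free. The terms are grouped as powers of
  \<open>N\<close> times tails, the form in which the asymptotic estimates are proved.\<close>

lemma prob_max_norm_le_second_moment:
  assumes \<Omega>: "finite \<Omega>" "\<Omega> \<noteq> {}" and unit: "\<And>\<omega>. \<omega> \<in> \<Omega> \<Longrightarrow> inner_on I (\<phi> \<omega>) (\<phi> \<omega>) = 1"
    and b: "\<And>\<omega>. \<omega> \<in> \<Omega> \<Longrightarrow> (\<Sum>\<omega>'\<in>\<Omega>. (inner_on I (\<phi> \<omega>) (\<phi> \<omega>'))\<^sup>2) \<le> b"
    and B: "real (card {(\<omega>, \<omega>') \<in> \<Omega> \<times> \<Omega>. \<omega> \<noteq> \<omega>' \<and> \<bar>inner_on I (\<phi> \<omega>) (\<phi> \<omega>')\<bar> \<ge> \<rho>}) \<le> card \<Omega>"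
    and \<rho>: "\<rho> < 1" and \<delta>: "0 < \<delta>" "\<delta> \<le> 1 / 2" and t: "t > 0"
  defines "N \<equiv> real (card \<Omega>)"
  shows "prob {x \<in> space M. max_norm \<Omega> (analysis_op I \<phi> (\<lambda>k. X k x)) \<le> \<sigma> * t} \<le>
    1 - 2 * c * (N * gauss_tail t) + c\<^sup>2 * (2 * (N * gauss_tail t) +
      2 * b * (N * gauss_tail (2 * t / sqrt (2 * (1 + \<rho>))) / \<delta>\<^sup>2) +
      (N\<^sup>2 * gauss_tail (2 * t) + (N * gauss_tail t) * (N * gauss_tail (t * (1 - 2 * \<delta>)))))"
proof -
  let ?A = "\<lambda>\<omega>. {x \<in> space M. t < \<bar>coeff (\<phi> \<omega>) x\<bar>}"
  let ?r = "\<lambda>\<omega> \<omega>'. inner_on I (\<phi> \<omega>) (\<phi> \<omega>')"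
  let ?G = "2 * gauss_tail (2 * t / sqrt (2 * (1 + \<rho>))) / \<delta>\<^sup>2"
  let ?C = "gauss_tail (2 * t) + gauss_tail t * gauss_tail (t * (1 - 2 * \<delta>))"
  have G: "?G \<ge> 0" by (simp add: gauss_tail_nonneg)
  \<comment> \<open>The diagonal is separated because \<open>B\<close> counts only pairs of distinct
    elements; on it the correlation is 1 and hence above \<open>\<rho>\<close>.\<close>
  have "(\<Sum>\<omega>\<in>\<Omega>. \<Sum>\<omega>'\<in>\<Omega>. prob (?A \<omega> \<inter> ?A \<omega>')) \<le>
    (\<Sum>\<omega>\<in>\<Omega>. \<Sum>\<omega>'\<in>\<Omega>. (if \<omega> = \<omega>' then gauss_tail t else 0) +
      (if \<omega> \<noteq> \<omega>' \<and> \<bar>?r \<omega> \<omega>'\<bar> \<ge> \<rho> then gauss_tail t else 0) + (?r \<omega> \<omega>')\<^sup>2 * ?G + ?C)"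
  proof (intro sum_mono)
    fix \<omega> \<omega>' assume "\<omega> \<in> \<Omega>" "\<omega>' \<in> \<Omega>"
    from prob_joint_coeff_gt[OF unit[OF this(1)] unit[OF this(2)] \<rho> \<delta> t]
    show "prob (?A \<omega> \<inter> ?A \<omega>') \<le> (if \<omega> = \<omega>' then gauss_tail t else 0) +
      (if \<omega> \<noteq> \<omega>' \<and> \<bar>?r \<omega> \<omega>'\<bar> \<ge> \<rho> then gauss_tail t else 0) + (?r \<omega> \<omega>')\<^sup>2 * ?G + ?C"
      using unit \<open>\<omega> \<in> \<Omega>\<close> \<rho> gauss_tail_nonneg[of t] by (auto split: if_splits)
  qed
  also have "\<dots> = N * gauss_tail t +
      real (card {(\<omega>, \<omega>') \<in> \<Omega> \<times> \<Omega>. \<omega> \<noteq> \<omega>' \<and> \<bar>?r \<omega> \<omega>'\<bar> \<ge> \<rho>}) * gauss_tail t +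
      (\<Sum>\<omega>\<in>\<Omega>. \<Sum>\<omega>'\<in>\<Omega>. (?r \<omega> \<omega>')\<^sup>2) * ?G + N\<^sup>2 * ?C"
  proof -
    have "(\<Sum>\<omega>\<in>\<Omega>. \<Sum>\<omega>'\<in>\<Omega>. if \<omega> \<noteq> \<omega>' \<and> \<bar>?r \<omega> \<omega>'\<bar> \<ge> \<rho> then gauss_tail t else 0) =
        (\<Sum>p\<in>\<Omega> \<times> \<Omega>. if fst p \<noteq> snd p \<and> \<bar>?r (fst p) (snd p)\<bar> \<ge> \<rho> then gauss_tail t else 0)"
      by (simp add: sum.cartesian_product case_prod_beta)
    also have "\<dots> = real (card {p \<in> \<Omega> \<times> \<Omega>. fst p \<noteq> snd p \<and> \<bar>?r (fst p) (snd p)\<bar> \<ge> \<rho>}) * gauss_tail t"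
      using \<Omega> by (subst sum.inter_filter[symmetric]) auto
    also have "{p \<in> \<Omega> \<times> \<Omega>. fst p \<noteq> snd p \<and> \<bar>?r (fst p) (snd p)\<bar> \<ge> \<rho>} =
        {(\<omega>, \<omega>') \<in> \<Omega> \<times> \<Omega>. \<omega> \<noteq> \<omega>' \<and> \<bar>?r \<omega> \<omega>'\<bar> \<ge> \<rho>}"
      by auto
    finally have pairs: "(\<Sum>\<omega>\<in>\<Omega>. \<Sum>\<omega>'\<in>\<Omega>. if \<omega> \<noteq> \<omega>' \<and> \<bar>?r \<omega> \<omega>'\<bar> \<ge> \<rho> then gauss_tail t else 0) =
        real (card {(\<omega>, \<omega>') \<in> \<Omega> \<times> \<Omega>. \<omega> \<noteq> \<omega>' \<and> \<bar>?r \<omega> \<omega>'\<bar> \<ge> \<rho>}) * gauss_tail t" .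
    have diag: "(\<Sum>\<omega>\<in>\<Omega>. \<Sum>\<omega>'\<in>\<Omega>. if \<omega> = \<omega>' then gauss_tail t else 0) = N * gauss_tail t"
      using \<Omega> by (simp add: N_def)
    have const: "(\<Sum>\<omega>\<in>\<Omega>. \<Sum>\<omega>'\<in>\<Omega>. x) = N\<^sup>2 * x" for x :: real
      by (simp add: N_def power2_eq_square)
    show ?thesis
      unfolding sum.distrib[of _ _ \<Omega>] sum_distrib_right[symmetric] pairs diag const
      by (simp only: distrib_left mult.assoc)
  qed
  \<comment> \<open>\<open>B\<close> turns the strongly correlated pairs into a second copy of the
    diagonal term, and \<open>b\<close> bounds each row of squared correlations.\<close>
  also have "\<dots> \<le> N * gauss_tail t + N * gauss_tail t + (N * b) * ?G + N\<^sup>2 * ?C"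
  proof (intro add_mono mult_right_mono order_refl)
    have "(\<Sum>\<omega>\<in>\<Omega>. \<Sum>\<omega>'\<in>\<Omega>. (?r \<omega> \<omega>')\<^sup>2) \<le> (\<Sum>\<omega>\<in>\<Omega>. b)"
      by (intro sum_mono b)
    then show "(\<Sum>\<omega>\<in>\<Omega>. \<Sum>\<omega>'\<in>\<Omega>. (?r \<omega> \<omega>')\<^sup>2) \<le> N * b"
      by (simp add: N_def)
  qed (use B G gauss_tail_nonneg in \<open>auto simp: N_def\<close>)
  also have "\<dots> = 2 * (N * gauss_tail t) +
      2 * b * (N * gauss_tail (2 * t / sqrt (2 * (1 + \<rho>))) / \<delta>\<^sup>2) +
      (N\<^sup>2 * gauss_tail (2 * t) + (N * gauss_tail t) * (N * gauss_tail (t * (1 - 2 * \<delta>))))"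
    by (simp add: power2_eq_square algebra_simps)
  finally have S: "(\<Sum>\<omega>\<in>\<Omega>. \<Sum>\<omega>'\<in>\<Omega>. prob (?A \<omega> \<inter> ?A \<omega>')) \<le> \<dots>" .
  have "2 * c * (\<Sum>\<omega>\<in>\<Omega>. prob (?A \<omega>)) - c\<^sup>2 * (\<Sum>\<omega>\<in>\<Omega>. \<Sum>\<omega>'\<in>\<Omega>. prob (?A \<omega> \<inter> ?A \<omega>'))
      \<le> prob (\<Union>\<omega>\<in>\<Omega>. ?A \<omega>)"
    by (rule prob_Union_ge_second_moment) (use \<Omega> in auto)
  moreover have "(\<Sum>\<omega>\<in>\<Omega>. prob (?A \<omega>)) = N * gauss_tail t"
    using unit by (simp add: prob_coeff_gt N_def)
  ultimately show ?thesis
    using mult_left_mono[OF S, of "c\<^sup>2"] \<Omega> by (simp add: prob_max_norm_le)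
qed

end

section \<open>Asymptotics of the threshold\<close>

text \<open>The threshold divided by \<open>\<sigma>\<close>, with the logarithm \<open>l\<close> of
  the number of frame elements as a real variable, so that limits can be taken over the
  reals.\<close>

definition std_threshold :: "real \<Rightarrow> real \<Rightarrow> real" where
  "std_threshold z l = sqrt (2 * l) + (2 * z - ln l - ln pi) / (2 * sqrt (2 * l))"

lemma std_threshold_le_iff: "0 < l \<Longrightarrow> std_threshold y l \<le> std_threshold z l \<longleftrightarrow> y \<le> z"
  by (simp add: std_threshold_def divide_le_cancel)

text \<open>Collects \<open>z\<close> and \<open>ln pi\<close> into the single constant that appears
  in the expansions.\<close>

lemma std_threshold_alt:
  "std_threshold z l = sqrt (2 * l) + (2 * (z - ln pi / 2) - ln l) / (2 * sqrt (2 * l))"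
  by (simp add: std_threshold_def algebra_simps)

lemma std_threshold_power2:
  assumes "l > 0"
  shows "(std_threshold z l)\<^sup>2 =
    2 * l + (2 * (z - ln pi / 2) - ln l) + (2 * (z - ln pi / 2) - ln l)\<^sup>2 / (8 * l)"
proof -
  have "sqrt (2 * l) * sqrt (2 * l) = 2 * l" using assms by simp
  then show ?thesis
    using assms by (simp add: std_threshold_alt power2_sum power_divide power_mult_distrib)
qed

lemma filterlim_std_threshold: "filterlim (std_threshold z) at_top at_top"
  unfolding std_threshold_alt[abs_def] by real_asymp

text \<open>With \<open>c = z - ln pi / 2\<close>, half the squared threshold is
  \<open>l + c - ln l / 2 + o(1)\<close>. The exponentials thus leave about
  \<open>sqrt l * exp (- c)\<close>, and division by the threshold, asymptotically
  \<open>sqrt (2 * l)\<close>, cancels the root.\<close>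

lemma tendsto_exp_std_threshold:
  "((\<lambda>l. exp l * (exp (- (std_threshold z l)\<^sup>2 / 2) / std_threshold z l)) \<longlongrightarrow>
     exp (- (z - ln pi / 2)) / sqrt 2) at_top"
proof (rule Lim_transform_eventually)
  define c where "c = z - ln pi / 2"
  show "((\<lambda>l. exp (ln l / 2 - c - (2 * c - ln l)\<^sup>2 / (16 * l)) / (sqrt (2 * l) + (2 * c - ln l) / (2 * sqrt (2 * l)))) \<longlongrightarrow>
      exp (- (z - ln pi / 2)) / sqrt 2) at_top"
    unfolding c_def[symmetric] by (real_asymp simp: powr_half_sqrt field_simps)
  show "\<forall>\<^sub>F l in at_top. exp (ln l / 2 - c - (2 * c - ln l)\<^sup>2 / (16 * l)) / (sqrt (2 * l) + (2 * c - ln l) / (2 * sqrt (2 * l))) =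
      exp l * (exp (- (std_threshold z l)\<^sup>2 / 2) / std_threshold z l)"
    using eventually_gt_at_top[of 0]
  proof eventually_elim
    case (elim l)
    have "l + - (std_threshold z l)\<^sup>2 / 2 = ln l / 2 - c - (2 * c - ln l)\<^sup>2 / (16 * l)"
      unfolding std_threshold_power2[OF elim] c_def[symmetric] by (simp add: field_simps)
    then have "exp (ln l / 2 - c - (2 * c - ln l)\<^sup>2 / (16 * l)) = exp l * exp (- (std_threshold z l)\<^sup>2 / 2)"
      by (simp only: flip: exp_add)
    then show ?case
      by (simp only: times_divide_eq_right std_threshold_alt[of z l, folded c_def, symmetric])
  qed
qed

text \<open>The factor 2 is slack over the limit; the bound still tends to 0 as \<open>z\<close>
  grows.\<close>

lemma eventually_tail_le:
  "\<forall>\<^sub>F l in at_top. exp l * gauss_tail (std_threshold z l) < 2 * exp (- (z - ln pi / 2)) / sqrt 2"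
proof -
  have "\<forall>\<^sub>F l in at_top. exp l * (exp (- (std_threshold z l)\<^sup>2 / 2) / std_threshold z l) < 2 * exp (- (z - ln pi / 2)) / sqrt 2"
    by (rule order_tendstoD(2)[OF tendsto_exp_std_threshold], rule divide_strict_right_mono) auto
  moreover have "\<forall>\<^sub>F l in at_top. std_threshold z l > 0"
    using filterlim_std_threshold by (simp add: filterlim_at_top_dense)
  ultimately show ?thesis
  proof eventually_elim
    case (elim l)
    have "exp l * gauss_tail (std_threshold z l) \<le> exp l * (exp (- (std_threshold z l)\<^sup>2 / 2) / std_threshold z l)"
      by (intro mult_left_mono gauss_tail_le elim) auto
    with elim show ?case by linarith
  qed
qed

text \<open>The same limit, halved for slack, is combined with the lower tail bound, which costs the
  constant \<open>C\<close>.\<close>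

lemma eventually_tail_ge:
  "\<exists>\<kappa>>0. \<forall>\<^sub>F l in at_top. \<kappa> \<le> exp l * gauss_tail (std_threshold z l)"
proof -
  define K where "K = exp (- (z - ln pi / 2)) / sqrt 2"
  have K: "K > 0" by (simp add: K_def)
  define C where "C = exp (- 3 / 2) / sqrt (2 * pi)"
  have C: "C > 0" by (simp add: C_def)
  have "\<forall>\<^sub>F l in at_top. exp l * (exp (- (std_threshold z l)\<^sup>2 / 2) / std_threshold z l) > K / 2"
    by (rule order_tendstoD(1)[OF tendsto_exp_std_threshold[of z], folded K_def]) (use K in simp)
  moreover have "\<forall>\<^sub>F l in at_top. std_threshold z l \<ge> 1"
    using filterlim_std_threshold by (simp add: filterlim_at_top)
  ultimately have "\<forall>\<^sub>F l in at_top. C * (K / 2) \<le> exp l * gauss_tail (std_threshold z l)"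
  proof eventually_elim
    case (elim l)
    have "C * (K / 2) \<le> C * (exp l * (exp (- (std_threshold z l)\<^sup>2 / 2) / std_threshold z l))"
      using elim C by (intro mult_left_mono) auto
    also have "\<dots> = exp l * (C * (exp (- (std_threshold z l)\<^sup>2 / 2) / std_threshold z l))"
      by simp
    also have "\<dots> \<le> exp l * gauss_tail (std_threshold z l)"
      unfolding C_def by (intro mult_left_mono gauss_tail_ge elim) auto
    finally show ?case .
  qed
  then show ?thesis using C K by (intro exI[of _ "C * (K / 2)"]) simp
qed

text \<open>Serves the nearly independent pairs with \<open>\<delta> = 1 / l\<close>: half the
  squared threshold is about \<open>l\<close>, so the factor \<open>1 - 2 / l\<close> lowers it by
  only about 4. This is the 4 in the limit \<open>exp (4 - c) / sqrt 2\<close>.\<close>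

lemma eventually_tail_shrunk_le:
  "\<exists>K. \<forall>\<^sub>F l in at_top. exp l * gauss_tail (std_threshold z l * (1 - 2 / l)) \<le> K"
proof -
  define c where "c = z - ln pi / 2"
  have "((\<lambda>l. exp (l - (l + (2 * c - ln l) / 2 + (2 * c - ln l)\<^sup>2 / (16 * l)) * (1 - 2 / l)\<^sup>2) /
      ((sqrt (2 * l) + (2 * c - ln l) / (2 * sqrt (2 * l))) * (1 - 2 / l))) \<longlongrightarrow> exp (4 - c) / sqrt 2) at_top"
    by (real_asymp simp: powr_half_sqrt field_simps)
  then have "\<forall>\<^sub>F l in at_top. exp (l - (l + (2 * c - ln l) / 2 + (2 * c - ln l)\<^sup>2 / (16 * l)) * (1 - 2 / l)\<^sup>2) /
      ((sqrt (2 * l) + (2 * c - ln l) / (2 * sqrt (2 * l))) * (1 - 2 / l)) < 2 * exp (4 - c) / sqrt 2"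
    by (rule order_tendstoD(2), intro divide_strict_right_mono) auto
  moreover have "\<forall>\<^sub>F l in at_top. std_threshold z l > 0"
    using filterlim_std_threshold by (simp add: filterlim_at_top_dense)
  ultimately have "\<forall>\<^sub>F l in at_top. exp l * gauss_tail (std_threshold z l * (1 - 2 / l)) \<le> 2 * exp (4 - c) / sqrt 2"
    using eventually_gt_at_top[of 2]
  proof eventually_elim
    case (elim l)
    let ?t = "std_threshold z l * (1 - 2 / l)"
    have "?t\<^sup>2 / 2 = (l + (2 * c - ln l) / 2 + (2 * c - ln l)\<^sup>2 / (16 * l)) * (1 - 2 / l)\<^sup>2"
    proof -
      have "(std_threshold z l)\<^sup>2 / 2 = l + (2 * c - ln l) / 2 + (2 * c - ln l)\<^sup>2 / (16 * l)"
        using elim by (simp add: std_threshold_power2 c_def[symmetric] field_simps)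
      then show ?thesis by (simp add: power_mult_distrib)
    qed
    moreover have "exp l * (exp (- ?t\<^sup>2 / 2) / ?t) = exp (l - ?t\<^sup>2 / 2) / ?t"
      by (simp flip: exp_add)
    ultimately have "exp l * (exp (- ?t\<^sup>2 / 2) / ?t) < 2 * exp (4 - c) / sqrt 2"
      using elim(1) by (simp only: std_threshold_alt c_def[symmetric])
    moreover have "exp l * gauss_tail ?t \<le> exp l * (exp (- ?t\<^sup>2 / 2) / ?t)"
      using elim by (intro mult_left_mono gauss_tail_le) auto
    ultimately show ?case by linarith
  qed
  then show ?thesis by blast
qed

lemma gauss_tail_le_exp: "1 \<le> t \<Longrightarrow> gauss_tail t \<le> exp (- t\<^sup>2 / 2)"
  by (rule order_trans[OF gauss_tail_le]) (auto simp: divide_le_eq mult_le_cancel_left1)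

text \<open>Doubling the threshold raises the exponent from about \<open>l\<close> to about
  \<open>4 * l\<close>, which beats the \<open>2 * l\<close> of the prefactor.\<close>

lemma eventually_tail_double_le:
  "\<forall>\<^sub>F l in at_top. (exp l)\<^sup>2 * gauss_tail (2 * std_threshold z l) \<le> 1"
proof -
  define c where "c = z - ln pi / 2"
  have "((\<lambda>l. exp (2 * l) * exp (- 2 * (2 * l + (2 * c - ln l) + (2 * c - ln l)\<^sup>2 / (8 * l)))) \<longlongrightarrow> 0) at_top"
    by real_asymp
  then have "\<forall>\<^sub>F l in at_top. exp (2 * l) * exp (- 2 * (2 * l + (2 * c - ln l) + (2 * c - ln l)\<^sup>2 / (8 * l))) < 1"
    by (rule order_tendstoD) simp
  moreover have "\<forall>\<^sub>F l in at_top. std_threshold z l \<ge> 1"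
    using filterlim_std_threshold by (simp add: filterlim_at_top)
  ultimately show ?thesis using eventually_gt_at_top[of 0]
  proof eventually_elim
    case (elim l)
    have "gauss_tail (2 * std_threshold z l) \<le> exp (- (2 * std_threshold z l)\<^sup>2 / 2)"
      using elim by (intro gauss_tail_le_exp) auto
    also have "- (2 * std_threshold z l)\<^sup>2 / 2 = - 2 * (std_threshold z l)\<^sup>2"
      by (simp add: power_mult_distrib)
    also have "\<dots> = - 2 * (2 * l + (2 * c - ln l) + (2 * c - ln l)\<^sup>2 / (8 * l))"
      using elim by (simp only: std_threshold_power2 c_def)
    finally have "(exp l)\<^sup>2 * gauss_tail (2 * std_threshold z l) \<le>
        exp (2 * l) * exp (- 2 * (2 * l + (2 * c - ln l) + (2 * c - ln l)\<^sup>2 / (8 * l)))"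
      by (auto simp: exp_double)
    with elim show ?case by linarith
  qed
qed

text \<open>The exponent of this tail is about \<open>2 * l / (1 + \<rho>)\<close>, larger than
  \<open>l\<close> by a fixed proportion. The surplus absorbs the square of \<open>l\<close>, which
  is \<open>1 / \<delta>^2\<close> for \<open>\<delta> = 1 / l\<close>.\<close>

lemma eventually_tail_rho_le:
  assumes \<rho>: "0 < \<rho>" "\<rho> < 1"
  shows "\<forall>\<^sub>F l in at_top. exp l * gauss_tail (2 * std_threshold z l / sqrt (2 * (1 + \<rho>))) * l\<^sup>2 \<le> 1"
proof -
  define c where "c = z - ln pi / 2"
  \<comment> \<open>\<open>1 / 2 + \<eta>\<close> equals \<open>1 / (1 + \<rho>)\<close>, so
    \<open>\<eta>\<close> measures the surplus in the exponent.\<close>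
  define \<eta> where "\<eta> = 1 / (1 + \<rho>) - 1 / 2"
  have "\<eta> > 0" using \<rho> by (simp add: \<eta>_def field_simps)
  then have "((\<lambda>l. exp l * l\<^sup>2 * exp (- (2 * l + (2 * c - ln l) + (2 * c - ln l)\<^sup>2 / (8 * l)) * (1 / 2 + \<eta>))) \<longlongrightarrow> 0) at_top"
    by real_asymp
  then have "\<forall>\<^sub>F l in at_top. exp l * l\<^sup>2 * exp (- (2 * l + (2 * c - ln l) + (2 * c - ln l)\<^sup>2 / (8 * l)) * (1 / 2 + \<eta>)) < 1"
    by (rule order_tendstoD) simp
  moreover have "\<forall>\<^sub>F l in at_top. std_threshold z l \<ge> 1"
    using filterlim_std_threshold by (simp add: filterlim_at_top)
  ultimately show ?thesis using eventually_gt_at_top[of 0]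
  proof eventually_elim
    case (elim l)
    have "sqrt (2 * (1 + \<rho>)) \<le> 2" using \<rho> by (intro real_le_lsqrt) auto
    then have "1 \<le> 2 * std_threshold z l / sqrt (2 * (1 + \<rho>))"
      using \<rho> elim by (simp add: le_divide_eq)
    then have "gauss_tail (2 * std_threshold z l / sqrt (2 * (1 + \<rho>))) \<le> exp (- (2 * std_threshold z l / sqrt (2 * (1 + \<rho>)))\<^sup>2 / 2)"
      by (rule gauss_tail_le_exp)
    also have "- (2 * std_threshold z l / sqrt (2 * (1 + \<rho>)))\<^sup>2 / 2 = - (std_threshold z l)\<^sup>2 * (1 / 2 + \<eta>)"
      using \<rho> by (simp add: power_mult_distrib power_divide \<eta>_def) (simp add: field_simps)
    also have "\<dots> = - (2 * l + (2 * c - ln l) + (2 * c - ln l)\<^sup>2 / (8 * l)) * (1 / 2 + \<eta>)"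
      using elim by (simp only: std_threshold_power2 c_def)
    finally have "exp l * l\<^sup>2 * gauss_tail (2 * std_threshold z l / sqrt (2 * (1 + \<rho>))) \<le>
        exp l * l\<^sup>2 * exp (- (2 * l + (2 * c - ln l) + (2 * c - ln l)\<^sup>2 / (8 * l)) * (1 / 2 + \<eta>))"
      by (intro mult_left_mono) auto
    with elim have "exp l * l\<^sup>2 * gauss_tail (2 * std_threshold z l / sqrt (2 * (1 + \<rho>))) \<le> 1" by linarith
    then show ?case by (simp only: mult_ac)
  qed
qed

text \<open>For fixed \<open>l > 0\<close> the threshold is an increasing function of
  \<open>z\<close> that can be solved for \<open>z\<close>. Divergence of the sequence therefore
  becomes a comparison with each fixed \<open>z\<close>, to which the tail estimates apply.\<close>

lemma threshold_form_iff:
  fixes \<Omega> :: "nat \<Rightarrow> 'w set"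
  assumes \<sigma>: "\<sigma> > 0" and L: "filterlim (\<lambda>n. ln (real (card (\<Omega> n)))) at_top sequentially"
  shows "threshold_form \<sigma> \<Omega> T \<longleftrightarrow>
    (\<forall>z. \<forall>\<^sub>F n in sequentially. \<sigma> * std_threshold z (ln (real (card (\<Omega> n)))) \<le> T n)"
proof
  let ?L = "\<lambda>n. ln (real (card (\<Omega> n)))"
  have ev: "\<forall>\<^sub>F n in sequentially. n \<ge> 1 \<and> ?L n > 0 \<and> card (\<Omega> n) \<ge> 2"
  proof -
    have "\<forall>\<^sub>F n in sequentially. ?L n > 0"
      using L by (simp add: filterlim_at_top_dense)
    then show ?thesis using eventually_ge_at_top[of 1]
    proof eventually_elim
      case (elim n)
      have "\<not> card (\<Omega> n) < 2"
      proof
        assume "card (\<Omega> n) < 2"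
        then have "card (\<Omega> n) = 0 \<or> card (\<Omega> n) = 1" by auto
        with elim show False by auto
      qed
      with elim show ?case by simp
    qed
  qed
  {
    assume "threshold_form \<sigma> \<Omega> T"
    then obtain z where z: "filterlim z at_top sequentially"
      and T: "\<And>n. n \<ge> 1 \<Longrightarrow> card (\<Omega> n) \<ge> 2 \<Longrightarrow> T n = \<sigma> * std_threshold (z n) (?L n)"
      unfolding threshold_form_def std_threshold_def Let_def distrib_left by blast
    show "\<forall>y. \<forall>\<^sub>F n in sequentially. \<sigma> * std_threshold y (?L n) \<le> T n"
    proof
      fix y
      have "\<forall>\<^sub>F n in sequentially. y \<le> z n"
        using z by (simp add: filterlim_at_top)
      with ev show "\<forall>\<^sub>F n in sequentially. \<sigma> * std_threshold y (?L n) \<le> T n"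
        by eventually_elim (use \<sigma> in \<open>simp add: T std_threshold_le_iff\<close>)
    qed
  next
    assume le: "\<forall>z. \<forall>\<^sub>F n in sequentially. \<sigma> * std_threshold z (?L n) \<le> T n"
    \<comment> \<open>The formula for \<open>T n\<close> solved for \<open>z n\<close>. Where
      \<open>card (\<Omega> n) < 2\<close> the value does not matter, as
      \<open>threshold_form\<close> imposes no condition there.\<close>
    define z where "z n = ((T n / \<sigma> - sqrt (2 * ?L n)) * (2 * sqrt (2 * ?L n)) + ln (?L n) + ln pi) / 2" for n
    have T: "T n = \<sigma> * std_threshold (z n) (?L n)" if "card (\<Omega> n) \<ge> 2" for n
    proof -
      have "sqrt (2 * ?L n) \<noteq> 0" using that by simp
      moreover have "2 * ((w + x + y) / 2) - x - y = w" for w x y :: real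
        by (simp add: field_simps)
      ultimately have "std_threshold (z n) (?L n) = T n / \<sigma>"
        by (simp only: std_threshold_def z_def) simp
      then show ?thesis using \<sigma> by simp
    qed
    have "filterlim z at_top sequentially"
      unfolding filterlim_at_top
    proof
      fix y
      from ev le[rule_format, of y] show "\<forall>\<^sub>F n in sequentially. y \<le> z n"
        by eventually_elim (use \<sigma> in \<open>simp add: T std_threshold_le_iff\<close>)
    qed
    with T show "threshold_form \<sigma> \<Omega> T"
      unfolding threshold_form_def Let_def std_threshold_def distrib_left by blast
  }
qed

section \<open>The denoising property\<close>

theorem proposition3p4:
  fixes d :: nat and \<sigma> :: real
    and \<Omega> :: "nat \<Rightarrow> 'w set"
    and \<phi> :: "nat \<Rightarrow> 'w \<Rightarrow> (nat \<Rightarrow> nat) \<Rightarrow> real"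
    and M :: "'a measure"
    and \<epsilon> :: "nat \<Rightarrow> (nat \<Rightarrow> nat) \<Rightarrow> 'a \<Rightarrow> real"
  assumes "d \<ge> 1" and "\<sigma> > 0"
    and "\<And>n. n \<ge> 1 \<Longrightarrow> is_frame (grid d n) (\<Omega> n) (\<phi> n)"
    and "\<And>n. n \<ge> 1 \<Longrightarrow> normalized (grid d n) (\<Omega> n) (\<phi> n)"
    and "prob_space M" and "gaussian_noise M d \<sigma> \<epsilon>"
  shows "(asymptotically_stable d \<Omega> \<phi> \<longrightarrow>
            (\<forall>T. denoising_property M d \<Omega> \<phi> \<epsilon> T \<longleftrightarrow> threshold_form \<sigma> \<Omega> T)) \<and>
         (\<forall>T. (\<forall>n\<ge>1. T n > 0) \<and> threshold_form \<sigma> \<Omega> T \<longrightarrow> denoising_property M d \<Omega> \<phi> \<epsilon> T)"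
proof -

  \<comment> \<open>Growth of the number of frame elements and monotonicity in the threshold\<close>
  note d = assms(1) and \<sigma> = assms(2) and frame = assms(3) and unit = assms(4) and noise = assms(6)
  interpret prob_space M by fact
  define N where "N n = real (card (\<Omega> n))" for n
  define L where "L n = ln (N n)" for n
  define P where "P n t = prob {x \<in> space M.
      max_norm (\<Omega> n) (analysis_op (grid d n) (\<phi> n) (\<lambda>k. \<epsilon> n k x)) \<le> t}" for n t
  have GV: "gaussian_vector M (grid d n) (\<epsilon> n) \<sigma>" if "n \<ge> 1" for n
    using noise that \<sigma> by unfold_locales (auto simp: gaussian_noise_def)
  \<comment> \<open>\<open>d \<ge> 1\<close> enters through \<open>n \<le> n ^ d\<close>. The
    resulting divergence of \<open>L\<close> lets the estimates in \<open>l\<close> be evaluated at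
    \<open>L n\<close>.\<close>
  have N_ge: "real n \<le> N n" if "n \<ge> 1" for n
  proof -
    have "n \<le> n ^ d" using d that by (simp add: self_le_power)
    also have "\<dots> \<le> card (\<Omega> n)"
      using card_le_card_of_is_frame[OF frame[OF that]] by (simp add: card_grid)
    finally show ?thesis by (simp add: N_def)
  qed
  have "filterlim N at_top sequentially"
    by (rule filterlim_at_top_mono[OF filterlim_real_sequentially])
       (use N_ge in \<open>auto simp: eventually_sequentially\<close>)
  then have L: "filterlim L at_top sequentially"
    unfolding L_def by (rule filterlim_compose[OF ln_at_top])
  have exp_L: "exp (L n) = N n" if "n \<ge> 1" for n
    using N_ge[OF that] that by (simp add: L_def)
  have \<Omega>: "finite (\<Omega> n)" "\<Omega> n \<noteq> {}" if "n \<ge> 1" for n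
    using frame[OF that] N_ge[OF that] that by (auto simp: is_frame_def N_def)
  have unit1: "inner_on (grid d n) (\<phi> n \<omega>) (\<phi> n \<omega>) = 1" if "n \<ge> 1" "\<omega> \<in> \<Omega> n" for n \<omega>
    using unit[OF that(1)] that(2) by (simp add: normalized_def flip: L2_set_power2)
  have rv: "{x \<in> space M. max_norm (\<Omega> n) (analysis_op (grid d n) (\<phi> n) (\<lambda>k. \<epsilon> n k x)) \<le> t} \<in> events"
    if "n \<ge> 1" for n t
  proof -
    have [measurable]: "random_variable borel (\<epsilon> n k)" if "k \<in> grid d n" for k
      using gaussian_vector.indep[OF GV[OF \<open>n \<ge> 1\<close>]] that unfolding indep_vars_def by blast
    have "{x \<in> space M. max_norm (\<Omega> n) (analysis_op (grid d n) (\<phi> n) (\<lambda>k. \<epsilon> n k x)) \<le> t} =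
        {x \<in> space M. \<forall>\<omega>\<in>\<Omega> n. \<bar>\<Sum>k\<in>grid d n. \<phi> n \<omega> k * \<epsilon> n k x\<bar> \<le> t}"
      using \<Omega>[OF that] by (simp add: max_norm_def analysis_op_def inner_on_def)
    also have "\<dots> \<in> events"
      using \<Omega>[OF that] by measurable
    finally show ?thesis .
  qed
  have P_mono: "P n s \<le> P n t" if "n \<ge> 1" "s \<le> t" for n s t
    unfolding P_def using rv[OF that(1)] that(2) by (intro finite_measure_mono) auto
  have form: "threshold_form \<sigma> \<Omega> T \<longleftrightarrow> (\<forall>z. \<forall>\<^sub>F n in sequentially. \<sigma> * std_threshold z (L n) \<le> T n)" for T
    using threshold_form_iff[OF \<sigma>, of \<Omega> T] L unfolding L_def N_def by blast
  have denoising: "denoising_property M d \<Omega> \<phi> \<epsilon> T \<longleftrightarrow> (\<lambda>n. P n (T n)) \<longlonglongrightarrow> 1" for T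
    by (simp add: denoising_property_def P_def)

  \<comment> \<open>Sufficiency of the threshold form, by the union bound\<close>
  have sufficient: "denoising_property M d \<Omega> \<phi> \<epsilon> T" if "threshold_form \<sigma> \<Omega> T" for T
    unfolding denoising
  proof (rule order_tendstoI)
    fix a :: real assume "a > 1"
    then show "\<forall>\<^sub>F n in sequentially. P n (T n) < a"
      by (intro always_eventually allI) (auto simp: P_def intro: le_less_trans[OF prob_le_1])
  next
    fix a :: real assume a: "a < 1"
    have "((\<lambda>z. 2 * exp (- (z - ln pi / 2)) / sqrt 2) \<longlongrightarrow> 0) at_top"
      by real_asymp
    then have "\<forall>\<^sub>F z in at_top. 2 * exp (- (z - ln pi / 2)) / sqrt 2 < 1 - a"
      by (rule order_tendstoD) (use a in simp)
    \<comment> \<open>A fixed \<open>z\<close> whose failure bound lies below the tolerance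
      \<open>1 - a\<close>; \<open>T n\<close> is eventually at least its threshold.\<close>
    then obtain z where z: "2 * exp (- (z - ln pi / 2)) / sqrt 2 < 1 - a"
      by (auto simp: eventually_at_top_linorder)
    have "\<forall>\<^sub>F n in sequentially. exp (L n) * gauss_tail (std_threshold z (L n)) < 2 * exp (- (z - ln pi / 2)) / sqrt 2"
      using eventually_tail_le L by (rule eventually_compose_filterlim)
    moreover have "\<forall>\<^sub>F n in sequentially. \<sigma> * std_threshold z (L n) \<le> T n"
      using that form by blast
    ultimately show "\<forall>\<^sub>F n in sequentially. a < P n (T n)"
      using eventually_ge_at_top[of 1]
    proof eventually_elim
      case (elim n)
      have "a < 1 - N n * gauss_tail (std_threshold z (L n))"
        using elim z by (simp add: exp_L)
      also have "\<dots> \<le> P n (\<sigma> * std_threshold z (L n))"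
        unfolding N_def P_def
        by (rule gaussian_vector.prob_max_norm_ge[OF GV]) (use elim \<Omega> unit1 in auto)
      also have "\<dots> \<le> P n (T n)"
        using elim by (intro P_mono) auto
      finally show ?case .
    qed
  qed

  \<comment> \<open>Necessity under asymptotic stability, by the second moment method\<close>
  have necessary: "threshold_form \<sigma> \<Omega> T"
    if stable: "asymptotically_stable d \<Omega> \<phi>" and T: "denoising_property M d \<Omega> \<phi> \<epsilon> T" for T
    unfolding form
  proof
    \<comment> \<open>It suffices to keep \<open>P\<close> at the threshold of this \<open>z\<close>
      away from 1: by monotonicity of \<open>P\<close>, a denoising \<open>T\<close> then cannot lie
      below that threshold infinitely often.\<close>
    fix z
    from stable obtain \<rho> where \<rho>: "0 < \<rho>" "\<rho> < 1"
      and pairs: "(\<lambda>n. real (card {(\<omega>, \<omega>') \<in> \<Omega> n \<times> \<Omega> n.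
                 \<omega> \<noteq> \<omega>' \<and> \<bar>inner_on (grid d n) (\<phi> n \<omega>) (\<phi> n \<omega>')\<bar> \<ge> \<rho>}))
          \<in> o(\<lambda>n. N n / sqrt (L n))"
      and bdd: "bdd_above ((\<lambda>n. upper_frame_bound (grid d n) (\<Omega> n) (\<phi> n)) ` {1..})"
      unfolding asymptotically_stable_def N_def L_def by blast
    from bdd obtain b' where b': "\<And>n. n \<ge> 1 \<Longrightarrow> upper_frame_bound (grid d n) (\<Omega> n) (\<phi> n) \<le> b'"
      unfolding bdd_above_def by auto
    \<comment> \<open>The absolute value ensures \<open>b \<ge> 0\<close>, used when an inequality
      is multiplied by \<open>2 * b\<close>.\<close>
    define b where "b = \<bar>b'\<bar>"
    have b: "(\<Sum>\<omega>'\<in>\<Omega> n. (inner_on (grid d n) (\<phi> n \<omega>) (\<phi> n \<omega>'))\<^sup>2) \<le> b" if "n \<ge> 1" "\<omega> \<in> \<Omega> n" for n \<omega>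
      using sum_inner_power2_le_upper_frame_bound[OF frame unit, of n \<omega>] b'[of n] that by (simp add: b_def)
    \<comment> \<open>The small-o bound is taken with constant 1, and
      \<open>sqrt (L n) \<ge> 1\<close> eventually.\<close>
    have pairs_le: "\<forall>\<^sub>F n in sequentially. real (card {(\<omega>, \<omega>') \<in> \<Omega> n \<times> \<Omega> n.
                 \<omega> \<noteq> \<omega>' \<and> \<bar>inner_on (grid d n) (\<phi> n \<omega>) (\<phi> n \<omega>')\<bar> \<ge> \<rho>}) \<le> card (\<Omega> n)"
    proof -
      have "\<forall>\<^sub>F n in sequentially. L n \<ge> 1"
        using L by (simp add: filterlim_at_top)
      with landau_o.smallD[OF pairs, of 1, simplified] show ?thesis
      proof eventually_elim
        case (elim n)
        have "N n / sqrt (L n) \<le> N n / 1"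
          using elim by (intro divide_left_mono) (auto simp: N_def)
        with elim show ?case by (simp add: N_def)
      qed
    qed
    obtain \<kappa> where "\<kappa> > 0" and "\<forall>\<^sub>F l in at_top. \<kappa> \<le> exp l * gauss_tail (std_threshold z l)"
      using eventually_tail_ge by blast
    define K where "K = 2 * exp (- (z - ln pi / 2)) / sqrt 2"
    have "K > 0" by (simp add: K_def)
    obtain K' where K': "\<forall>\<^sub>F l in at_top. exp l * gauss_tail (std_threshold z l * (1 - 2 / l)) \<le> K'"
      using eventually_tail_shrunk_le by blast
    \<comment> \<open>\<open>S\<close> adds the bounds for the second moment: \<open>2 * K\<close>
      for the diagonal and the strongly correlated pairs, \<open>2 * b\<close> for the middle range,
      \<open>1 + K * \<bar>K'\<bar>\<close> for the nearly independent pairs.\<close>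
    define S where "S = 2 * K + 2 * b + (1 + K * \<bar>K'\<bar>)"
    have "S > 0" using \<open>K > 0\<close> by (simp add: S_def b_def add_pos_nonneg)
    have "\<forall>\<^sub>F l in at_top. \<kappa> \<le> exp l * gauss_tail (std_threshold z l) \<and>
        exp l * gauss_tail (std_threshold z l) < K \<and>
        exp l * gauss_tail (std_threshold z l * (1 - 2 / l)) \<le> K' \<and>
        (exp l)\<^sup>2 * gauss_tail (2 * std_threshold z l) \<le> 1 \<and>
        exp l * gauss_tail (2 * std_threshold z l / sqrt (2 * (1 + \<rho>))) * l\<^sup>2 \<le> 1 \<and>
        std_threshold z l > 0 \<and> l \<ge> 2"
      unfolding K_def
      by (intro eventually_conj eventually_tail_le eventually_tail_double_le eventually_tail_rho_le \<rho>
            eventually_ge_at_top K' \<open>\<forall>\<^sub>F l in at_top. \<kappa> \<le> _ l\<close>)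
         (use filterlim_std_threshold in \<open>simp add: filterlim_at_top_dense\<close>)
    then have ev: "\<forall>\<^sub>F n in sequentially. \<kappa> \<le> exp (L n) * gauss_tail (std_threshold z (L n)) \<and>
        exp (L n) * gauss_tail (std_threshold z (L n)) < K \<and>
        exp (L n) * gauss_tail (std_threshold z (L n) * (1 - 2 / L n)) \<le> K' \<and>
        (exp (L n))\<^sup>2 * gauss_tail (2 * std_threshold z (L n)) \<le> 1 \<and>
        exp (L n) * gauss_tail (2 * std_threshold z (L n) / sqrt (2 * (1 + \<rho>))) * (L n)\<^sup>2 \<le> 1 \<and>
        std_threshold z (L n) > 0 \<and> L n \<ge> 2"
      using L by (rule eventually_compose_filterlim)
    \<comment> \<open>This value minimises \<open>1 - 2 * c * \<kappa> + c^2 * S\<close>; the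
      minimum is \<open>1 - \<kappa>^2 / S\<close>.\<close>
    define c where "c = \<kappa> / S"
    have "c > 0" using \<open>\<kappa> > 0\<close> \<open>S > 0\<close> by (simp add: c_def)
    have bound: "\<forall>\<^sub>F n in sequentially. P n (\<sigma> * std_threshold z (L n)) \<le> 1 - \<kappa>\<^sup>2 / S"
      using ev pairs_le eventually_ge_at_top[of 1]
    proof eventually_elim
      case (elim n)
      let ?t = "std_threshold z (L n)"
      \<comment> \<open>Here \<open>\<delta> = 1 / L n\<close>; the requirement
        \<open>\<delta> \<le> 1 / 2\<close> is met because \<open>L n \<ge> 2\<close>.\<close>
      have "P n (\<sigma> * ?t) \<le> 1 - 2 * c * (N n * gauss_tail ?t) + c\<^sup>2 * (2 * (N n * gauss_tail ?t) +
          2 * b * (N n * gauss_tail (2 * ?t / sqrt (2 * (1 + \<rho>))) / (1 / L n)\<^sup>2) +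
          ((N n)\<^sup>2 * gauss_tail (2 * ?t) + (N n * gauss_tail ?t) * (N n * gauss_tail (?t * (1 - 2 * (1 / L n))))))"
        unfolding N_def P_def
        by (rule gaussian_vector.prob_max_norm_le_second_moment[OF GV])
           (use elim \<Omega> unit1 b \<rho> in auto)
      also have "\<dots> \<le> 1 - 2 * c * \<kappa> + c\<^sup>2 * S"
        unfolding S_def
      proof (intro add_mono diff_mono mult_left_mono order_refl)
        show "2 * b * (N n * gauss_tail (2 * ?t / sqrt (2 * (1 + \<rho>))) / (1 / L n)\<^sup>2) \<le> 2 * b"
        proof -
          have "N n * gauss_tail (2 * ?t / sqrt (2 * (1 + \<rho>))) / (1 / L n)\<^sup>2 \<le> 1"
            using elim by (simp add: exp_L power_divide)
          from mult_left_mono[OF this, of "2 * b"] show ?thesis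
            by (simp only: mult_1_right) (simp add: b_def)
        qed
        show "(N n * gauss_tail ?t) * (N n * gauss_tail (?t * (1 - 2 * (1 / L n)))) \<le> K * \<bar>K'\<bar>"
          using elim \<open>K > 0\<close> by (intro mult_mono) (auto simp: exp_L N_def gauss_tail_nonneg)
      qed (use elim \<open>c > 0\<close> in \<open>auto simp: exp_L\<close>)
      also have "\<dots> = 1 - \<kappa>\<^sup>2 / S"
        using \<open>S > 0\<close> by (simp add: c_def power2_eq_square field_simps)
      finally show ?case .
    qed
    have "\<forall>\<^sub>F n in sequentially. 1 - \<kappa>\<^sup>2 / S < P n (T n)"
      by (rule order_tendstoD[OF T[unfolded denoising]]) (use \<open>\<kappa> > 0\<close> \<open>S > 0\<close> in simp)
    with bound show "\<forall>\<^sub>F n in sequentially. \<sigma> * std_threshold z (L n) \<le> T n"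
      using eventually_ge_at_top[of 1]
    proof eventually_elim
      case (elim n)
      show ?case
      proof (rule ccontr)
        assume "\<not> \<sigma> * std_threshold z (L n) \<le> T n"
        with elim have "P n (T n) \<le> P n (\<sigma> * std_threshold z (L n))"
          by (intro P_mono) auto
        with elim show False by linarith
      qed
    qed
  qed

  show ?thesis using sufficient necessary by blast
qed

end
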